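(* Let $\mathbb{k}$ be an algebraically closed field of characteristic zero. The potentials $$f_{Q_{18}}=x^8+y^3+xz^2\in\mathbb{k}[x,y,z],\qquad f_{E_{30}}=u^8w+v^3+w^2\in\mathbb{k}[u,v,w],$$ with gradings $|x|=\tfrac14,\ |y|=\tfrac23,\ |z|=\tfrac78,\ |u|=\tfrac18,\ |v|=\tfrac23,\ |w|=1$ (so that both potentials have degree $2$), are orbifold equivalent.
   Context: Graded rings and potentials. Each variable of a polynomial ring $R=\mathbb{k}[x_1,\ldots,x_m]$ carries a fixed degree $|x_i|\in\mathbb{Q}_{>0}$, so that $R=\bigoplus_{q\in\mathbb{Q}_{\ge 0}}R_q$; elements of the $R_q$ are called quasi-homogeneous. For $f\in R$ the Jacobian ideal is $I_f=(\partial_{x_1}f,\ldots,\partial_{x_m}f)$. A potential is a quasi-homogeneous $f\in R$ such that $R/I_f$ is a non-zero finite-dimensional $\mathbb{k}$-vector space. Graded modules. For $n\in\mathbb{Q}$, $R(n)$ is $R$ as an $R$-module with grading $R(n)_m=R_{n+m}$. A finitely generated free graded $R$-module is one isomorphic to $R(n_1)\oplus\cdots\oplus R(n_\ell)$ with $n_i\in\mathbb{Q}$. It is supergraded if it is given a decomposition $X=X_+\oplus X_-$ (even and odd part) into finitely generated free graded $R$-modules. A map between graded modules is quasi-homogeneous of degree $\ell$ if it raises degree by $\ell$. Matrix factorizations. For potentials $f\in R=\mathbb{k}[x_1,\ldots,x_m]$ and $g\in S=\mathbb{k}[y_1,\ldots,y_n]$, let $T=R\otimes_{\mathbb{k}}S=\mathbb{k}[x_1,\ldots,x_m,y_1,\ldots,y_n]$.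 A matrix factorization of $f-g$ is a finitely generated free graded, supergraded $T$-module $Q$ together with an odd, quasi-homogeneous $T$-linear endomorphism $d_Q$ (of some degree) with $d_Q^2=(f-g)\cdot\mathrm{Id}_Q$. Residues. For $f_1,\ldots,f_m\in \mathbb{k}[x_1,\ldots,x_m]$ generating an ideal that contains a power of $(x_1,\ldots,x_m)$, the residue symbol $\mathrm{res}\left(\frac{h\,\mathrm{d}x_1\wedge\cdots\wedge\mathrm{d}x_m}{f_1,\ldots,f_m}\right)$ is linear in $h$ and is characterized by: (F1) it is $0$ if $h\in(f_1,\ldots,f_m)$; (F2) for $f_i=x_i^{d_i}$ it is the coefficient of $x_1^{d_1-1}\cdots x_m^{d_m-1}$ in $h$; (F3) replacing $h$ by $h\det M$ and the vector $(f_1,\ldots,f_m)$ by $M(f_1,\ldots,f_m)$ does not change it, for $M$ an $m\times m$ matrix over the polynomial ring (such that the new symbol is defined). If $h$ depends on further variables, these are treated as parameters, i.e. the residue is extended linearly over polynomials in them. Quantum dimensions. Choosing a quasi-homogeneous basis compatible with the supergrading, regard $d_Q$ as a matrix over $T$ and write $\partial_{x_i}Q,\partial_{y_j}Q$ for its entrywise partial derivatives; $\mathrm{str}$ is the supertrace (trace on the even part minus trace on the odd part). Then $$\mathrm{qdim}_f Q=\mathrm{res}\left(\frac{\mathrm{str}(\partial_{x_1}Q\cdots\partial_{x_m}Q\,\partial_{y_1}Q\cdots\partial_{y_n}Q)\,\mathrm{d}x_1\wedge\cdots\wedge\mathrm{d}x_m}{\partial_{x_1}f,\ldots,\partial_{x_m}f}\right),$$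 and $\mathrm{qdim}_g Q$ is defined by the same formula with $\mathrm{d}y_1\wedge\cdots\wedge\mathrm{d}y_n$ in the numerator and $\partial_{y_1}g,\ldots,\partial_{y_n}g$ in the denominator (signs are irrelevant here). These are the left and right quantum dimensions. Orbifold equivalence. Potentials $f$ and $g$ are orbifold equivalent if there is a matrix factorization of $f-g$ with non-zero left and right quantum dimensions. *)

theory Defs
  imports
    "HOL-Library.Poly_Mapping"
    "HOL-Computational_Algebra.Polynomial"
    "Jordan_Normal_Form.Determinant"
begin

subsection \<open>Polynomials in a finite list of variables\<close>

text \<open>
  \<open>('v, 'k) mpoly\<close> is the polynomial ring over \<open>'k\<close> in all variables of type \<open>'v\<close>.  For a list
  \<open>xs\<close> of distinct variables, \<open>poly_ring xs\<close> is its subring $k[xs]$.  If \<open>xs @ ys\<close> is distinct,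
  $k[xs] \otimes k[ys]$ is \<open>poly_ring (xs @ ys)\<close>, and both factors are subsets of it.
\<close>

type_synonym ('v, 'k) mpoly = "('v \<Rightarrow>\<^sub>0 nat) \<Rightarrow>\<^sub>0 'k"

definition Var :: "'v \<Rightarrow> ('v, 'k::comm_ring_1) mpoly" where
  "Var x = Poly_Mapping.single (Poly_Mapping.single x 1) 1"

definition Const :: "'k \<Rightarrow> ('v, 'k::comm_ring_1) mpoly" where
  "Const c = Poly_Mapping.single 0 c"

definition poly_ring :: "'v list \<Rightarrow> ('v, 'k::comm_ring_1) mpoly set" where
  "poly_ring xs = {p. \<forall>m \<in> Poly_Mapping.keys p. Poly_Mapping.keys m \<subseteq> set xs}"

definition partial :: "'v \<Rightarrow> ('v, 'k::comm_ring_1) mpoly \<Rightarrow> ('v, 'k) mpoly" where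
  "partial x p = (\<Sum>m \<in> Poly_Mapping.keys p.
     Poly_Mapping.single (m - Poly_Mapping.single x 1)
       (of_nat (Poly_Mapping.lookup m x) * Poly_Mapping.lookup p m))"

definition poly_vecs :: "'v list \<Rightarrow> nat \<Rightarrow> ('v, 'k::comm_ring_1) mpoly vec set" where
  "poly_vecs xs l = {v \<in> carrier_vec l. \<forall>i<l. v $ i \<in> poly_ring xs}"

definition poly_mats :: "'v list \<Rightarrow> nat \<Rightarrow> ('v, 'k::comm_ring_1) mpoly mat set" where
  "poly_mats xs l = {M \<in> carrier_mat l l. \<forall>i<l. \<forall>j<l. M $$ (i, j) \<in> poly_ring xs}"

definition generated_ideal ::
    "'v list \<Rightarrow> ('v, 'k::comm_ring_1) mpoly vec \<Rightarrow> ('v, 'k) mpoly set" where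
  "generated_ideal xs fs = {a \<bullet> fs | a. a \<in> poly_vecs xs (dim_vec fs)}"

definition gradient :: "'v list \<Rightarrow> ('v, 'k::comm_ring_1) mpoly \<Rightarrow> ('v, 'k) mpoly vec" where
  "gradient xs f = vec_of_list (map (\<lambda>x. partial x f) xs)"

subsection \<open>Gradings and potentials\<close>

text \<open>The variable \<open>x\<close> has degree \<open>wt x\<close>; the graded part is zero if no monomial has degree \<open>q\<close>.\<close>

definition mono_deg :: "('v \<Rightarrow> rat) \<Rightarrow> ('v \<Rightarrow>\<^sub>0 nat) \<Rightarrow> rat" where
  "mono_deg wt m = (\<Sum>x \<in> Poly_Mapping.keys m. of_nat (Poly_Mapping.lookup m x) * wt x)"

definition graded_part ::
    "('v \<Rightarrow> rat) \<Rightarrow> 'v list \<Rightarrow> rat \<Rightarrow> ('v, 'k::comm_ring_1) mpoly set" where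
  "graded_part wt xs q = {p \<in> poly_ring xs. \<forall>m \<in> Poly_Mapping.keys p. mono_deg wt m = q}"

definition potential :: "('v \<Rightarrow> rat) \<Rightarrow> 'v list \<Rightarrow> ('v, 'k::field) mpoly \<Rightarrow> bool" where
  "potential wt xs f \<longleftrightarrow>
     distinct xs \<and> (\<forall>x \<in> set xs. wt x > 0) \<and>
     (\<exists>q. f \<in> graded_part wt xs q) \<and>
     generated_ideal xs (gradient xs f) \<noteq> poly_ring xs \<and>
     (\<exists>B. finite B \<and> B \<subseteq> poly_ring xs \<and>
        (\<forall>p \<in> poly_ring xs. \<exists>c.
           p - (\<Sum>b\<in>B. Const (c b) * b) \<in> generated_ideal xs (gradient xs f)))"

subsection \<open>Matrix factorizations\<close>

text \<open>
  A finitely generated free graded module over \<open>T = poly_ring vs\<close> is presented as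
  \<open>T(n\<^sub>1) \<oplus> \<dots> \<oplus> T(n\<^sub>l)\<close> with \<open>ns = [n\<^sub>1, \<dots>, n\<^sub>l]\<close>, i.e. as column vectors over \<open>T\<close>.
  \<open>module_part wt vs ns q\<close> is its degree \<open>q\<close> part; note that \<open>T(n)\<close> has degree \<open>q\<close> part
  \<open>T\<^bsub>n + q\<^esub>\<close>.  A supergraded module is given by the shifts \<open>ns0\<close> of the even part and \<open>ns1\<close> of
  the odd part, the even coordinates being listed first, and an endomorphism by its matrix in
  the standard basis.
\<close>

definition module_part ::
    "('v \<Rightarrow> rat) \<Rightarrow> 'v list \<Rightarrow> rat list \<Rightarrow> rat \<Rightarrow> ('v, 'k::comm_ring_1) mpoly vec set" where
  "module_part wt vs ns q =
     {v \<in> carrier_vec (length ns). \<forall>i < length ns. v $ i \<in> graded_part wt vs (ns ! i + q)}"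

definition even_part :: "'v list \<Rightarrow> nat \<Rightarrow> nat \<Rightarrow> ('v, 'k::comm_ring_1) mpoly vec set" where
  "even_part vs r s = {v \<in> poly_vecs vs (r + s). \<forall>i. r \<le> i \<and> i < r + s \<longrightarrow> v $ i = 0}"

definition odd_part :: "'v list \<Rightarrow> nat \<Rightarrow> nat \<Rightarrow> ('v, 'k::comm_ring_1) mpoly vec set" where
  "odd_part vs r s = {v \<in> poly_vecs vs (r + s). \<forall>i < r. v $ i = 0}"

definition odd_map :: "'v list \<Rightarrow> nat \<Rightarrow> nat \<Rightarrow> ('v, 'k::comm_ring_1) mpoly mat \<Rightarrow> bool" where
  "odd_map vs r s D \<longleftrightarrow>
     (\<forall>v \<in> even_part vs r s. D *\<^sub>v v \<in> odd_part vs r s) \<and>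
     (\<forall>v \<in> odd_part vs r s. D *\<^sub>v v \<in> even_part vs r s)"

definition quasi_homogeneous_map ::
    "('v \<Rightarrow> rat) \<Rightarrow> 'v list \<Rightarrow> rat list \<Rightarrow> rat \<Rightarrow> ('v, 'k::comm_ring_1) mpoly mat \<Rightarrow> bool" where
  "quasi_homogeneous_map wt vs ns d D \<longleftrightarrow>
     (\<forall>q. \<forall>v \<in> module_part wt vs ns q. D *\<^sub>v v \<in> module_part wt vs ns (q + d))"

definition matrix_factorization ::
    "('v \<Rightarrow> rat) \<Rightarrow> 'v list \<Rightarrow> ('v, 'k::comm_ring_1) mpoly \<Rightarrow>
     rat list \<Rightarrow> rat list \<Rightarrow> ('v, 'k) mpoly mat \<Rightarrow> bool" where
  "matrix_factorization wt vs h ns0 ns1 D \<longleftrightarrow>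
     (let r = length ns0; s = length ns1 in
        D \<in> poly_mats vs (r + s) \<and>
        odd_map vs r s D \<and>
        (\<exists>d. quasi_homogeneous_map wt vs (ns0 @ ns1) d D) \<and>
        D * D = h \<cdot>\<^sub>m 1\<^sub>m (r + s))"

subsection \<open>Residues\<close>

text \<open>
  The symbol with denominators \<open>fs\<close> is defined if the ideal generated by \<open>fs\<close> contains a power of
  the ideal of the variables; the \<open>N\<close>-th power is generated by the \<open>N\<close>-fold products of variables.
\<close>

definition residue_defined :: "'v list \<Rightarrow> ('v, 'k::comm_ring_1) mpoly vec \<Rightarrow> bool" where
  "residue_defined xs fs \<longleftrightarrow>
     fs \<in> poly_vecs xs (length xs) \<and>
     (\<exists>N. \<forall>l. set l \<subseteq> set xs \<and> length l = N \<longrightarrow>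
        prod_list (map Var l) \<in> generated_ideal xs fs)"

text \<open>
  The characterization of the residue symbol \<open>Res h fs\<close>.  In (F2) all exponents are positive; for
  an exponent \<open>0\<close> the ideal is the whole ring and (F1) forces the symbol to vanish.
\<close>

definition residue_symbol ::
    "'v list \<Rightarrow> (('v, 'k::comm_ring_1) mpoly \<Rightarrow> ('v, 'k) mpoly vec \<Rightarrow> 'k) \<Rightarrow> bool" where
  "residue_symbol xs Res \<longleftrightarrow>
     \<comment> \<open>linearity\<close>
     (\<forall>fs. residue_defined xs fs \<longrightarrow>
        (\<forall>h \<in> poly_ring xs. \<forall>h' \<in> poly_ring xs. Res (h + h') fs = Res h fs + Res h' fs) \<and>
        (\<forall>c. \<forall>h \<in> poly_ring xs. Res (Const c * h) fs = c * Res h fs)) \<and>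
     \<comment> \<open>(F1)\<close>
     (\<forall>fs. residue_defined xs fs \<longrightarrow> (\<forall>h \<in> generated_ideal xs fs. Res h fs = 0)) \<and>
     \<comment> \<open>(F2)\<close>
     (\<forall>d. (\<forall>x \<in> set xs. d x \<ge> 1) \<longrightarrow>
        (\<forall>h \<in> poly_ring xs.
           Res h (vec_of_list (map (\<lambda>x. Var x ^ d x) xs)) =
           Poly_Mapping.lookup h (\<Sum>x \<in> set xs. Poly_Mapping.single x (d x - 1)))) \<and>
     \<comment> \<open>(F3)\<close>
     (\<forall>fs M. residue_defined xs fs \<and> M \<in> poly_mats xs (length xs) \<and>
          residue_defined xs (M *\<^sub>v fs) \<longrightarrow>
        (\<forall>h \<in> poly_ring xs. Res (h * det M) (M *\<^sub>v fs) = Res h fs))"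

text \<open>The properties above determine the symbol uniquely wherever it is defined.\<close>

definition residue ::
    "'v list \<Rightarrow> ('v, 'k::comm_ring_1) mpoly \<Rightarrow> ('v, 'k) mpoly vec \<Rightarrow> 'k" where
  "residue xs = (SOME Res. residue_symbol xs Res)"

definition restrict_mono :: "'v set \<Rightarrow> ('v \<Rightarrow>\<^sub>0 nat) \<Rightarrow> ('v \<Rightarrow>\<^sub>0 nat)" where
  "restrict_mono A m = Poly_Mapping.mapp (\<lambda>x e. if x \<in> A then e else 0) m"

text \<open>
  Linear extension over polynomials in the parameters, that is, in the variables outside \<open>xs\<close>:
  each monomial of \<open>h\<close> is split into its \<open>xs\<close>-part and its parameter part.
\<close>

definition param_residue ::
    "'v list \<Rightarrow> ('v, 'k::comm_ring_1) mpoly \<Rightarrow> ('v, 'k) mpoly vec \<Rightarrow> ('v, 'k) mpoly" where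
  "param_residue xs h fs = (\<Sum>m \<in> Poly_Mapping.keys h.
     Poly_Mapping.single (restrict_mono (- set xs) m)
       (Poly_Mapping.lookup h m *
        residue xs (Poly_Mapping.single (restrict_mono (set xs) m) 1) fs))"

subsection \<open>Quantum dimensions and orbifold equivalence\<close>

definition supertrace :: "nat \<Rightarrow> nat \<Rightarrow> 'a::comm_ring_1 mat \<Rightarrow> 'a" where
  "supertrace r s A = (\<Sum>i<r. A $$ (i, i)) - (\<Sum>i = r..<r + s. A $$ (i, i))"

definition deriv_product ::
    "'v list \<Rightarrow> ('v, 'k::comm_ring_1) mpoly mat \<Rightarrow> ('v, 'k) mpoly mat" where
  "deriv_product vs D =
     foldr (\<lambda>x A. map_mat (partial x) D * A) vs (1\<^sub>m (dim_row D))"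

text \<open>
  \<open>r\<close> and \<open>s\<close> are the ranks of the even and the odd part.
  The numerator is the same for both quantum dimensions.
\<close>

definition qdim_left ::
    "'v list \<Rightarrow> ('v, 'k::comm_ring_1) mpoly \<Rightarrow> 'v list \<Rightarrow>
     nat \<Rightarrow> nat \<Rightarrow> ('v, 'k) mpoly mat \<Rightarrow> ('v, 'k) mpoly" where
  "qdim_left xs f ys r s D =
     param_residue xs (supertrace r s (deriv_product (xs @ ys) D)) (gradient xs f)"

definition qdim_right ::
    "'v list \<Rightarrow> 'v list \<Rightarrow> ('v, 'k::comm_ring_1) mpoly \<Rightarrow>
     nat \<Rightarrow> nat \<Rightarrow> ('v, 'k) mpoly mat \<Rightarrow> ('v, 'k) mpoly" where
  "qdim_right xs ys g r s D =
     param_residue ys (supertrace r s (deriv_product (xs @ ys) D)) (gradient ys g)"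

definition orbifold_equivalent ::
    "('v \<Rightarrow> rat) \<Rightarrow> 'v list \<Rightarrow> ('v, 'k::field) mpoly \<Rightarrow> 'v list \<Rightarrow> ('v, 'k) mpoly \<Rightarrow> bool" where
  "orbifold_equivalent wt xs f ys g \<longleftrightarrow>
     set xs \<inter> set ys = {} \<and> potential wt xs f \<and> potential wt ys g \<and>
     (\<exists>ns0 ns1 D.
        matrix_factorization wt (xs @ ys) (f - g) ns0 ns1 D \<and>
        qdim_left xs f ys (length ns0) (length ns1) D \<noteq> 0 \<and>
        qdim_right xs ys g (length ns0) (length ns1) D \<noteq> 0)"

subsection \<open>The two potentials\<close>

datatype variable = X | Y | Z | U | V | W

primrec weight :: "variable \<Rightarrow> rat" where
  "weight X = 1/4"
| "weight Y = 2/3"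
| "weight Z = 7/8"
| "weight U = 1/8"
| "weight V = 2/3"
| "weight W = 1"

definition f_Q18 :: "(variable, 'k::comm_ring_1) mpoly" where
  "f_Q18 = Var X ^ 8 + Var Y ^ 3 + Var X * Var Z ^ 2"

definition f_E30 :: "(variable, 'k::comm_ring_1) mpoly" where
  "f_E30 = Var U ^ 8 * Var W + Var V ^ 3 + Var W ^ 2"

end

(* Choose mu with mu^16 = -1/4 and put s = mu u, w' = w + u^8/2 and
   h = x^7 + x^6 s^2 + ... + s^14.  Then
     f - g = (x - s^2)(z^2 + h) + (s z - w')(s z + w') + (y - v)(y^2 + y v + v^2),
   and the associated Koszul matrix factorization of rank 4 + 4 works: up to sign, the supertrace of
   the product of the partial derivatives is the Jacobian determinant of the six factors, and the
   parameter-free parts of the two residues are non-zero multiples of res(y z^2) and res(v u^14).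

   The residue symbol exists: if A f is a vector of positive powers x_i^(d_i), let the residue of h
   be the coefficient of prod x_i^(d_i - 1) in h det A.  By Cramer's rule det A is unique modulo the
   powers x_i^(d_i), so this does not depend on A. *)
theory Submission
  imports Defs
begin

subsection \<open>Polynomials as finitely supported functions\<close>

text \<open>On the hypersurface x = s^2 the term x^8 + x z^2 becomes s^16 + (s z)^2, and completing
  the square turns g into w'^2 - u^16/4 + v^3. The condition on mu says s^16 = -u^16/4, so f - g
  restricts to (s z)^2 - w'^2 + y^3 - v^3; the remainder is divisible by x - s^2. This produces the
  three products.

  Both Jacobian rings have top degree 29/12, which is also the degree of the supertrace. The quantum
  dimensions are therefore constants, and testing them at the trivial parameter monomial loses
  nothing.

  The obstacle is that \<open>residue\<close> is a choice among functions with (F1) to (F3): nothing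
  can be said about it before one such function is constructed. Afterwards its values are derived
  from these properties. Determinants are compared in the ring of polynomials in all variables,
  where an ideal generated by powers of variables can be tested monomial by monomial.\<close>

lemma poly_mapping_sum_single:
  "(\<Sum>m \<in> Poly_Mapping.keys p. Poly_Mapping.single m (Poly_Mapping.lookup p m)) = p"
proof (rule poly_mapping_eqI)
  fix k
  have "(\<Sum>m \<in> Poly_Mapping.keys p. (Poly_Mapping.lookup p m when m = k)) = Poly_Mapping.lookup p k"
    by (simp add: when_def in_keys_iff)
  then show "Poly_Mapping.lookup
       (\<Sum>m \<in> Poly_Mapping.keys p. Poly_Mapping.single m (Poly_Mapping.lookup p m)) k =
      Poly_Mapping.lookup p k"
    by (simp add: lookup_sum lookup_single)
qed

lemma poly_mapping_induct [case_names zero single add]: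
  fixes p :: "'a \<Rightarrow>\<^sub>0 'b::comm_monoid_add"
  assumes zero: "P 0" and single: "\<And>m c. P (Poly_Mapping.single m c)"
    and add: "\<And>p q. P p \<Longrightarrow> P q \<Longrightarrow> P (p + q)"
  shows "P p"
proof -
  have "P (\<Sum>m \<in> A. Poly_Mapping.single m (Poly_Mapping.lookup p m))" if "finite A" for A
    using that by (induction A) (simp_all add: zero single add)
  from this[of "Poly_Mapping.keys p"] show ?thesis
    by (simp add: poly_mapping_sum_single)
qed

text \<open>Exponents cancel, so at most one monomial of \<open>p\<close> contributes. This is the
  source both of the nonzerodivisor property of powers of variables and of the comparison of
  residues taken with different exponents.\<close>

lemma lookup_times_single_add:
  fixes p :: "'a::cancel_comm_monoid_add \<Rightarrow>\<^sub>0 'b::comm_semiring_0"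
  shows "Poly_Mapping.lookup (p * Poly_Mapping.single m c) (n + m) = Poly_Mapping.lookup p n * c"
  by (induction p rule: poly_mapping_induct)
     (simp_all add: mult_single lookup_single lookup_add distrib_right when_def)

lemma add_diff_single:
  fixes m :: "'v \<Rightarrow>\<^sub>0 nat"
  assumes "Poly_Mapping.lookup m x \<ge> e"
  shows "m - Poly_Mapping.single x e + Poly_Mapping.single x e = m"
  by (rule poly_mapping_eqI) (use assms in \<open>auto simp: lookup_add lookup_minus lookup_single when_def\<close>)

lemma Var_power: "Var x ^ n = Poly_Mapping.single (Poly_Mapping.single x n) 1"
  by (induction n) (simp_all add: Var_def mult_single flip: single_add)

lemma Const_1 [simp]: "Const 1 = 1"
  by (simp add: Const_def)

lemma Const_mult: "Const (a * b) = Const a * Const b"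
  by (simp add: Const_def mult_single)

lemma Const_power: "Const (a ^ n) = Const a ^ n"
  by (induction n) (simp_all add: Const_mult)

lemma Const_numeral [simp]: "Const (numeral n) = numeral n"
  by (simp add: Const_def)

lemma Const_uminus: "Const (- a) = - Const a"
  by (simp add: Const_def single_uminus)

lemma single_power:
  "Poly_Mapping.single (Poly_Mapping.single x a) c ^ n =
   Poly_Mapping.single (Poly_Mapping.single x (n * a)) (c ^ n :: 'k::comm_ring_1)"
  by (induction n) (simp_all add: mult_single flip: single_add)

lemma single_0_power:
  "Poly_Mapping.single 0 c ^ n = Poly_Mapping.single (0 :: 'v \<Rightarrow>\<^sub>0 nat) (c ^ n :: 'k::comm_ring_1)"
  by (induction n) (simp_all add: mult_single)

lemmas monomial_simps = Var_def Const_def mult_single single_power single_0_power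

lemma lookup_Const_mult:
  "Poly_Mapping.lookup (Const c * p) m = c * Poly_Mapping.lookup p m"
  using lookup_times_single_add[of p 0 c m] by (simp add: Const_def ac_simps)

section \<open>Closure properties of the subring of polynomials in given variables\<close>

lemma poly_ring_add: "p \<in> poly_ring xs \<Longrightarrow> q \<in> poly_ring xs \<Longrightarrow> p + q \<in> poly_ring xs"
  using keys_add[of p q] by (auto simp: poly_ring_def)

lemma keys_uminus_poly [simp]:
  fixes p :: "'a \<Rightarrow>\<^sub>0 'b::ab_group_add"
  shows "Poly_Mapping.keys (- p) = Poly_Mapping.keys p"
  by (auto simp: in_keys_iff)

lemma poly_ring_uminus: "p \<in> poly_ring xs \<Longrightarrow> - p \<in> poly_ring xs"
  by (simp add: poly_ring_def)

lemma poly_ring_diff: "p \<in> poly_ring xs \<Longrightarrow> q \<in> poly_ring xs \<Longrightarrow> p - q \<in> poly_ring xs"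
  using poly_ring_add[OF _ poly_ring_uminus, of p xs q] by simp

lemma keys_add_nat:
  fixes m n :: "'v \<Rightarrow>\<^sub>0 nat"
  shows "Poly_Mapping.keys (m + n) = Poly_Mapping.keys m \<union> Poly_Mapping.keys n"
  by (auto simp: in_keys_iff lookup_add)

lemma poly_ring_mult:
  assumes "p \<in> poly_ring xs" "q \<in> poly_ring xs"
  shows "p * q \<in> poly_ring xs"
proof -
  have "Poly_Mapping.keys m \<subseteq> set xs" if m: "m \<in> Poly_Mapping.keys (p * q)" for m
  proof -
    obtain a b where "m = a + b" "a \<in> Poly_Mapping.keys p" "b \<in> Poly_Mapping.keys q"
      using keys_mult[of p q] m by blast
    with assms show ?thesis
      by (auto simp: poly_ring_def keys_add_nat)
  qed
  then show ?thesis by (auto simp: poly_ring_def)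
qed

lemma poly_ring_single: "Poly_Mapping.keys m \<subseteq> set xs \<Longrightarrow> Poly_Mapping.single m c \<in> poly_ring xs"
  by (auto simp: poly_ring_def)

lemma poly_ring_0 [simp]: "0 \<in> poly_ring xs"
  by (simp add: poly_ring_def)

lemma poly_ring_Const [simp]: "Const c \<in> poly_ring xs"
  by (simp add: Const_def poly_ring_single)

lemma poly_ring_1 [simp]: "1 \<in> poly_ring xs"
  using poly_ring_Const[of 1] by simp

lemma poly_ring_numeral [simp]: "numeral n \<in> poly_ring xs"
  using poly_ring_Const[of "numeral n"] by simp

lemma poly_ring_Var [simp]: "Var x \<in> poly_ring xs \<longleftrightarrow> x \<in> set xs"
  by (simp add: poly_ring_def Var_def)

lemma poly_ring_power: "p \<in> poly_ring xs \<Longrightarrow> p ^ n \<in> poly_ring xs"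
  by (induction n) (simp_all add: poly_ring_mult)

lemma poly_ring_sum: "(\<And>i. i \<in> I \<Longrightarrow> f i \<in> poly_ring xs) \<Longrightarrow> sum f I \<in> poly_ring xs"
  by (induction I rule: infinite_finite_induct) (simp_all add: poly_ring_add)

lemma poly_ring_prod_list:
  "(\<And>p. p \<in> set ps \<Longrightarrow> p \<in> poly_ring xs) \<Longrightarrow> prod_list ps \<in> poly_ring xs"
  by (induction ps) (simp_all add: poly_ring_mult)

lemmas poly_ring_intros =
  poly_ring_add poly_ring_diff poly_ring_uminus poly_ring_mult poly_ring_power poly_ring_sum

subsection \<open>Monomial ideals generated by powers of variables\<close>

text \<open>
  The ideal generated by the powers \<open>x ^ d x\<close> for \<open>x \<in> S\<close>, in the ring of polynomials in all
  variables.
\<close>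

definition powers_ideal :: "'v set \<Rightarrow> ('v \<Rightarrow> nat) \<Rightarrow> ('v, 'k::comm_ring_1) mpoly set" where
  "powers_ideal S d = {p. \<forall>m \<in> Poly_Mapping.keys p. \<exists>x \<in> S. d x \<le> Poly_Mapping.lookup m x}"

lemma powers_ideal_0 [simp]: "0 \<in> powers_ideal S d"
  by (simp add: powers_ideal_def)

lemma powers_ideal_add:
  "p \<in> powers_ideal S d \<Longrightarrow> q \<in> powers_ideal S d \<Longrightarrow> p + q \<in> powers_ideal S d"
  using keys_add[of p q] by (force simp: powers_ideal_def)

lemma powers_ideal_uminus: "p \<in> powers_ideal S d \<Longrightarrow> - p \<in> powers_ideal S d"
  by (simp add: powers_ideal_def)

lemma powers_ideal_mult:
  assumes "p \<in> powers_ideal S d"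
  shows "q * p \<in> powers_ideal S d"
  unfolding powers_ideal_def
proof safe
  fix m assume "m \<in> Poly_Mapping.keys (q * p)"
  then obtain a b where m: "m = a + b" and b: "b \<in> Poly_Mapping.keys p"
    using keys_mult[of q p] by blast
  obtain x where "x \<in> S" "d x \<le> Poly_Mapping.lookup b x"
    using assms b by (auto simp: powers_ideal_def)
  then show "\<exists>x \<in> S. d x \<le> Poly_Mapping.lookup m x"
    by (auto simp: m lookup_add intro!: bexI[of _ x])
qed

lemma powers_ideal_mult': "p \<in> powers_ideal S d \<Longrightarrow> p * q \<in> powers_ideal S d"
  using powers_ideal_mult[of p S d q] by (simp add: mult.commute)

lemma powers_ideal_sum:
  "(\<And>i. i \<in> I \<Longrightarrow> f i \<in> powers_ideal S d) \<Longrightarrow> sum f I \<in> powers_ideal S d"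
  by (induction I rule: infinite_finite_induct) (simp_all add: powers_ideal_add)

lemma powers_ideal_mono: "S \<subseteq> S' \<Longrightarrow> powers_ideal S d \<subseteq> powers_ideal S' d"
  by (force simp: powers_ideal_def)

lemma Var_power_in_powers_ideal: "x \<in> S \<Longrightarrow> Var x ^ d x \<in> powers_ideal S d"
  by (auto simp: powers_ideal_def Var_power intro!: bexI[of _ x])

lemma Var_in_powers_ideal: "x \<in> S \<Longrightarrow> Var x \<in> powers_ideal S (\<lambda>_. 1)"
  using Var_power_in_powers_ideal[of x S "\<lambda>_. 1"] by simp

lemma power_in_powers_ideal: "p \<in> powers_ideal S d \<Longrightarrow> p ^ numeral n \<in> powers_ideal S d"
  by (simp add: numeral_eq_Suc powers_ideal_mult')

lemmas powers_ideal_intros =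
  powers_ideal_add powers_ideal_mult power_in_powers_ideal Var_in_powers_ideal

text \<open>The factor shifts exponents of \<open>y\<close> only, and the generators of the ideal do
  not involve \<open>y\<close>.\<close>

lemma powers_ideal_cancel:
  assumes "p * Var y ^ e \<in> powers_ideal S d" "y \<notin> S"
  shows "p \<in> powers_ideal S d"
  unfolding powers_ideal_def
proof safe
  fix m assume "m \<in> Poly_Mapping.keys p"
  then have "m + Poly_Mapping.single y e \<in> Poly_Mapping.keys (p * Var y ^ e)"
    using lookup_times_single_add[of p "Poly_Mapping.single y e" 1 m]
    by (simp add: Var_power in_keys_iff)
  then obtain x where x: "x \<in> S" "d x \<le> Poly_Mapping.lookup (m + Poly_Mapping.single y e) x"
    using assms(1) by (auto simp: powers_ideal_def)
  moreover have "x \<noteq> y" using x assms(2) by auto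
  ultimately show "\<exists>x\<in>S. d x \<le> Poly_Mapping.lookup m x"
    by (auto simp: lookup_add lookup_single when_def)
qed

text \<open>Such coefficients are well defined modulo the ideal. The lemma is applied to
  \<open>top_mono\<close>, to the constant term, and to monomials free of parameters.\<close>

lemma lookup_powers_ideal:
  assumes "p \<in> powers_ideal S d" "\<And>x. x \<in> S \<Longrightarrow> Poly_Mapping.lookup m x < d x"
  shows "Poly_Mapping.lookup p m = 0"
  using assms by (force simp: powers_ideal_def in_keys_iff)

subsection \<open>Existence of the residue symbol\<close>

definition powers_vec :: "'v list \<Rightarrow> ('v \<Rightarrow> nat) \<Rightarrow> ('v, 'k::comm_ring_1) mpoly vec" where
  "powers_vec xs d = vec_of_list (map (\<lambda>x. Var x ^ d x) xs)"

lemma dim_powers_vec [simp]: "dim_vec (powers_vec xs d) = length xs"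
  by (simp add: powers_vec_def)

lemma powers_vec_carrier [simp]: "powers_vec xs d \<in> carrier_vec (length xs)"
  by (simp add: carrier_vecI)

lemma powers_vec_index [simp]:
  "i < length xs \<Longrightarrow> powers_vec xs d $ i = Var (xs ! i) ^ d (xs ! i)"
  by (simp add: powers_vec_def vec_of_list_index)

lemma mult_mat_vec_in_powers_ideal:
  assumes "A \<in> carrier_mat n m" "v \<in> carrier_vec m" "i < n"
    and "\<And>j. j < m \<Longrightarrow> v $ j \<in> powers_ideal S d"
  shows "(A *\<^sub>v v) $ i \<in> powers_ideal S d"
  using assms by (auto simp: scalar_prod_def intro!: powers_ideal_sum powers_ideal_mult)

lemma mult_mat_smult_vec:
  fixes A :: "'a::comm_ring_1 mat"
  assumes "A \<in> carrier_mat nr nc" "v \<in> carrier_vec nc"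
  shows "A *\<^sub>v (c \<cdot>\<^sub>v v) = c \<cdot>\<^sub>v (A *\<^sub>v v)"
  using assms by (intro eq_vecI) auto

lemma adj_mat_mult_vec:
  fixes E :: "'a::comm_ring_1 mat"
  assumes E: "E \<in> carrier_mat n n" and v: "v \<in> carrier_vec n"
  shows "adj_mat E *\<^sub>v (E *\<^sub>v v) = det E \<cdot>\<^sub>v v"
proof -
  have "adj_mat E *\<^sub>v (E *\<^sub>v v) = (det E \<cdot>\<^sub>m 1\<^sub>m n) *\<^sub>v v"
    using adj_mat[OF E] E v by (metis assoc_mult_mat_vec)
  also have "\<dots> = det E \<cdot>\<^sub>v v"
    using v by (intro eq_vecI) auto
  finally show ?thesis .
qed

text \<open>
  Cramer's rule puts \<open>det E\<close> times the \<open>k\<close>-th power into the ideal of the other powers, and the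
  \<open>k\<close>-th power is a nonzerodivisor modulo these.
\<close>

lemma det_in_powers_ideal:
  assumes xs: "distinct xs" "length xs = n" and f: "f \<in> carrier_vec n"
    and A: "A \<in> carrier_mat n n" "A *\<^sub>v f = powers_vec xs d"
    and E: "E \<in> carrier_mat n n" and k: "k < n"
    and Ek: "(E *\<^sub>v f) $ k = 0"
    and Ej: "\<And>j. j < n \<Longrightarrow> j \<noteq> k \<Longrightarrow> (E *\<^sub>v f) $ j = powers_vec xs d $ j"
  shows "det E \<in> powers_ideal (set xs) d"
proof -
  let ?S = "set xs - {xs ! k}"
  have adj: "adj_mat E \<in> carrier_mat n n" using adj_mat(1)[OF E] .
  have Ef: "E *\<^sub>v f \<in> carrier_vec n" using E f by simp
  have "det E * Var (xs ! k) ^ d (xs ! k) = (det E \<cdot>\<^sub>v (A *\<^sub>v f)) $ k"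
    using k xs by (simp add: A(2))
  also have "\<dots> = (A *\<^sub>v (adj_mat E *\<^sub>v (E *\<^sub>v f))) $ k"
    using A(1) f by (simp add: adj_mat_mult_vec[OF E f] mult_mat_smult_vec[of _ n n])
  also have "\<dots> = ((A * adj_mat E) *\<^sub>v (E *\<^sub>v f)) $ k"
    using A(1) adj Ef by (metis assoc_mult_mat_vec)
  \<comment> \<open>\<open>E *\<^sub>v f\<close> has entry 0 in place \<open>k\<close> and the other
    powers elsewhere, so this is a combination of the other powers only.\<close>
  also have "\<dots> \<in> powers_ideal ?S d"
  proof (rule mult_mat_vec_in_powers_ideal[OF _ Ef k])
    fix j assume j: "j < n"
    show "(E *\<^sub>v f) $ j \<in> powers_ideal ?S d"
    proof (cases "j = k")
      case False
      then have "xs ! j \<in> ?S"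
        using j k xs by (auto simp: nth_eq_iff_index_eq)
      then show ?thesis
        using Ej[OF j False] j xs by (simp add: Var_power_in_powers_ideal)
    qed (simp add: Ek)
  qed (use A(1) adj in simp)
  finally have "det E \<in> powers_ideal ?S d"
    by (rule powers_ideal_cancel) simp
  then show ?thesis
    using powers_ideal_mono[of ?S "set xs"] by blast
qed

text \<open>The rows of \<open>A\<close> are exchanged for those of \<open>B\<close> one at a time.
  By linearity in the row, each exchange changes the determinant by that of a matrix whose new row
  is a difference. That row annihilates \<open>f\<close> and the other rows still produce the
  powers, which is the situation of \<open>det_in_powers_ideal\<close>.\<close>

lemma det_diff_in_powers_ideal:
  fixes A B :: "('v, 'k::comm_ring_1) mpoly mat"
  assumes xs: "distinct xs" "length xs = n" and f: "f \<in> carrier_vec n"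
    and A: "A \<in> carrier_mat n n" "A *\<^sub>v f = powers_vec xs d"
    and B: "B \<in> carrier_mat n n" "B *\<^sub>v f = powers_vec xs d"
  shows "det B - det A \<in> powers_ideal (set xs) d"
proof -
  define C where "C i = mat\<^sub>r n n (\<lambda>r. if r < i then row B r else row A r)" for i
  have Af: "row A j \<bullet> f = powers_vec xs d $ j" if "j < n" for j
    using that A by (metis carrier_matD(1) index_mult_mat_vec)
  have Bf: "row B j \<bullet> f = powers_vec xs d $ j" if "j < n" for j
    using that B by (metis carrier_matD(1) index_mult_mat_vec)
  have rA: "row A j \<in> carrier_vec n" and rB: "row B j \<in> carrier_vec n" for j
    using A(1) B(1) by auto
  have rC: "row (C i) j = (if j < i then row B j else row A j)" if "j < n" for i j
    unfolding C_def using that rA rB by auto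
  have "det (C i) - det A \<in> powers_ideal (set xs) d" if "i \<le> n" for i
    using that
  proof (induction i)
    case 0
    have "C 0 = A" unfolding C_def by (rule eq_rowI) (use A(1) in auto)
    then show ?case by simp
  next
    case (Suc i)
    let ?c = "\<lambda>r. if r < i then row B r else row A r"
    define D where "D = mat\<^sub>r n n (\<lambda>r. if r = i then row B r - row A r else ?c r)"
    have i: "i < n" using Suc.prems by simp
    have 1: "C (Suc i) = mat\<^sub>r n n (\<lambda>r. if r = i then row A r + (row B r - row A r) else ?c r)"
      unfolding C_def
      by (rule arg_cong[of _ _ "mat\<^sub>r n n"]) (use A(1) B(1) in \<open>auto simp: fun_eq_iff intro!: eq_vecI\<close>)
    have 2: "C i = mat\<^sub>r n n (\<lambda>r. if r = i then row A r else ?c r)"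
      unfolding C_def by (rule arg_cong[of _ _ "mat\<^sub>r n n"]) (auto simp: fun_eq_iff)
    have *: "det (C (Suc i)) = det (C i) + det D"
      unfolding 1 2 D_def using i rA rB by (intro det_row_add) auto
    have "det D \<in> powers_ideal (set xs) d"
    proof (rule det_in_powers_ideal[OF xs f A _ i])
      have rD: "row D j = (if j = i then row B j - row A j else ?c j)" if "j < n" for j
        unfolding D_def using that rA rB by auto
      show D: "D \<in> carrier_mat n n" by (simp add: D_def)
      have "(row B i - row A i) \<bullet> f = row B i \<bullet> f - row A i \<bullet> f"
        by (rule minus_scalar_prod_distrib[OF rB rA f])
      then show "(D *\<^sub>v f) $ i = 0"
        using D i by (simp add: rD Af Bf)
      show "(D *\<^sub>v f) $ j = powers_vec xs d $ j" if "j < n" "j \<noteq> i" for j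
        using D that by (simp add: rD Af Bf)
    qed
    from powers_ideal_add[OF this Suc.IH] i show ?case
      by (simp add: * algebra_simps)
  qed
  from this[of n] have "det (C n) - det A \<in> powers_ideal (set xs) d" by simp
  moreover have "C n = B" unfolding C_def by (rule eq_rowI) (use B(1) in auto)
  ultimately show ?thesis by simp
qed

text \<open>The exponents of the monomial read off by the property (F2).\<close>

definition top_mono :: "'v list \<Rightarrow> ('v \<Rightarrow> nat) \<Rightarrow> ('v \<Rightarrow>\<^sub>0 nat)" where
  "top_mono xs d = (\<Sum>x \<in> set xs. Poly_Mapping.single x (d x - 1))"

lemma lookup_top_mono:
  "Poly_Mapping.lookup (top_mono xs d) x = (if x \<in> set xs then d x - 1 else 0)"
  by (simp add: top_mono_def lookup_sum lookup_single when_def)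

lemma prod_Var_power:
  "(\<Prod>x\<in>A. Var x ^ e x) = Poly_Mapping.single (\<Sum>x\<in>A. Poly_Mapping.single x (e x)) 1"
  by (induction A rule: infinite_finite_induct) (simp_all add: Var_power mult_single)

text \<open>Row \<open>i\<close> is multiplied by the missing power of the \<open>i\<close>-th
  variable. The determinant gains a monomial factor, and the top monomial is shifted by the same
  monomial.\<close>

lemma raise_powers_vec:
  fixes A :: "('v, 'k::comm_ring_1) mpoly mat"
  assumes xs: "distinct xs" "length xs = n" and f: "f \<in> carrier_vec n"
    and A: "A \<in> carrier_mat n n" "A *\<^sub>v f = powers_vec xs d"
    and d: "\<forall>x \<in> set xs. 1 \<le> d x \<and> d x \<le> e x"
  obtains P where "P \<in> carrier_mat n n" "P *\<^sub>v f = powers_vec xs e"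
    "\<And>h. Poly_Mapping.lookup (h * det P) (top_mono xs e) =
          Poly_Mapping.lookup (h * det A) (top_mono xs d)"
proof
  let ?q = "\<lambda>i. Var (xs ! i) ^ (e (xs ! i) - d (xs ! i)) :: ('v, 'k) mpoly"
  define P where "P = mat\<^sub>r n n (\<lambda>i. ?q i \<cdot>\<^sub>v row A i)"
  have rA: "row A j \<in> carrier_vec n" for j
    using A(1) by auto
  have Af: "row A j \<bullet> f = powers_vec xs d $ j" if "j < n" for j
    using that A by (metis carrier_matD(1) index_mult_mat_vec)
  show P: "P \<in> carrier_mat n n" by (simp add: P_def)
  show "P *\<^sub>v f = powers_vec xs e"
  proof (rule eq_vecI)
    fix i assume "i < dim_vec (powers_vec xs e)"
    then have i: "i < n" by (simp add: xs)
    have rP: "row P i = ?q i \<cdot>\<^sub>v row A i"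
      unfolding P_def using i A(1) by (intro row_mat_of_row_fun) auto
    have "(P *\<^sub>v f) $ i = row P i \<bullet> f"
      using P i by simp
    also have "\<dots> = ?q i * (row A i \<bullet> f)"
      unfolding rP using f rA[of i] by simp
    also have "\<dots> = powers_vec xs e $ i"
      using i d xs by (simp add: Af flip: power_add)
    finally show "(P *\<^sub>v f) $ i = powers_vec xs e $ i" .
  qed (use P xs in simp)
  have "det P = prod ?q {0..<n} * det (mat\<^sub>r n n (row A))"
    unfolding P_def using rA by (intro det_rows_mul) auto
  also have "mat\<^sub>r n n (row A) = A"
    by (rule eq_rowI) (use A(1) in auto)
  also have "prod ?q {0..<n} = (\<Prod>x\<in>set xs. Var x ^ (e x - d x))"
    using xs by (intro prod.reindex_bij_betw bij_betw_nth) (auto simp: atLeast0LessThan)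
  finally have det: "det P =
      Poly_Mapping.single (\<Sum>x\<in>set xs. Poly_Mapping.single x (e x - d x)) 1 * det A"
    by (simp add: prod_Var_power)
  \<comment> \<open>Subtraction is truncated: e - 1 = (d - 1) + (e - d) relies on 1 \<le> d and d
    \<le> e.\<close>
  have top: "top_mono xs e = top_mono xs d + (\<Sum>x\<in>set xs. Poly_Mapping.single x (e x - d x))"
    unfolding top_mono_def sum.distrib[symmetric]
    by (rule sum.cong) (use d in \<open>auto simp flip: single_add\<close>)
  show "Poly_Mapping.lookup (h * det P) (top_mono xs e) =
        Poly_Mapping.lookup (h * det A) (top_mono xs d)" for h
    using lookup_times_single_add[of "h * det A" "\<Sum>x\<in>set xs. Poly_Mapping.single x (e x - d x)" 1
        "top_mono xs d"]
    by (simp add: det top mult.assoc mult.commute mult.left_commute)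
qed

text \<open>Different exponent vectors are compared after raising both to their pointwise maximum.
  There the determinants agree modulo the powers, and the top monomial stays below all of
  these.\<close>

lemma lookup_det_unique:
  fixes A B :: "('v, 'k::comm_ring_1) mpoly mat"
  assumes xs: "distinct xs" "length xs = n" and f: "f \<in> carrier_vec n"
    and A: "A \<in> carrier_mat n n" "A *\<^sub>v f = powers_vec xs d"
    and B: "B \<in> carrier_mat n n" "B *\<^sub>v f = powers_vec xs e"
    and d: "\<forall>x \<in> set xs. 1 \<le> d x" and e: "\<forall>x \<in> set xs. 1 \<le> e x"
  shows "Poly_Mapping.lookup (h * det A) (top_mono xs d) =
         Poly_Mapping.lookup (h * det B) (top_mono xs e)"
proof -
  let ?c = "\<lambda>x. max (d x) (e x)"
  obtain P where P: "P \<in> carrier_mat n n" "P *\<^sub>v f = powers_vec xs ?c"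
    "\<And>h. Poly_Mapping.lookup (h * det P) (top_mono xs ?c) =
          Poly_Mapping.lookup (h * det A) (top_mono xs d)"
    using raise_powers_vec[OF xs f A, of ?c] d by auto
  obtain Q where Q: "Q \<in> carrier_mat n n" "Q *\<^sub>v f = powers_vec xs ?c"
    "\<And>h. Poly_Mapping.lookup (h * det Q) (top_mono xs ?c) =
          Poly_Mapping.lookup (h * det B) (top_mono xs e)"
    using raise_powers_vec[OF xs f B, of ?c] e by auto
  have "h * (det P - det Q) \<in> powers_ideal (set xs) ?c"
    by (intro powers_ideal_mult det_diff_in_powers_ideal[OF xs f Q(1,2) P(1,2)])
  then have "Poly_Mapping.lookup (h * (det P - det Q)) (top_mono xs ?c) = 0"
  proof (rule lookup_powers_ideal)
    fix x assume x: "x \<in> set xs"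
    then have "1 \<le> ?c x" using d by auto
    then show "Poly_Mapping.lookup (top_mono xs ?c) x < ?c x"
      unfolding lookup_top_mono using x by simp
  qed
  then show ?thesis
    by (simp add: right_diff_distrib lookup_minus P(3) Q(3))
qed

section \<open>Ideals generated by the entries of a vector, and the residue symbol built from
  determinants\<close>

lemma generated_ideal_add:
  assumes "p \<in> generated_ideal xs f" "q \<in> generated_ideal xs f"
  shows "p + q \<in> generated_ideal xs f"
proof -
  obtain a b where ab: "p = a \<bullet> f" "q = b \<bullet> f"
      "a \<in> poly_vecs xs (dim_vec f)" "b \<in> poly_vecs xs (dim_vec f)"
    using assms by (auto simp: generated_ideal_def)
  then have "a + b \<in> poly_vecs xs (dim_vec f)" "p + q = (a + b) \<bullet> f"
    by (auto simp: poly_vecs_def poly_ring_add add_scalar_prod_distrib[of _ "dim_vec f"])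
  then show ?thesis by (auto simp: generated_ideal_def)
qed

lemma generated_ideal_mult:
  assumes "p \<in> generated_ideal xs f" "q \<in> poly_ring xs"
  shows "q * p \<in> generated_ideal xs f"
proof -
  obtain a where a: "p = a \<bullet> f" "a \<in> poly_vecs xs (dim_vec f)"
    using assms by (auto simp: generated_ideal_def)
  then have "q \<cdot>\<^sub>v a \<in> poly_vecs xs (dim_vec f)" "q * p = (q \<cdot>\<^sub>v a) \<bullet> f"
    using assms by (auto simp: poly_vecs_def poly_ring_mult)
  then show ?thesis by (auto simp: generated_ideal_def)
qed

lemma generated_ideal_0: "0 \<in> generated_ideal xs f"
proof -
  have "0\<^sub>v (dim_vec f) \<in> poly_vecs xs (dim_vec f)" by (simp add: poly_vecs_def)
  moreover have "0\<^sub>v (dim_vec f) \<bullet> f = 0" by simp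
  ultimately show ?thesis unfolding generated_ideal_def by force
qed

lemma generated_ideal_sum:
  "(\<And>i. i \<in> I \<Longrightarrow> g i \<in> generated_ideal xs f) \<Longrightarrow> sum g I \<in> generated_ideal xs f"
  by (induction I rule: infinite_finite_induct) (simp_all add: generated_ideal_0 generated_ideal_add)

text \<open>Pure powers occur among the \<open>N\<close>-fold products; their coefficient vectors
  form the rows of \<open>A\<close>.\<close>

lemma residue_defined_powers:
  fixes f :: "('v, 'k::comm_ring_1) mpoly vec"
  assumes "residue_defined xs f"
  obtains A d where "A \<in> carrier_mat (length xs) (length xs)" "\<forall>x \<in> set xs. 1 \<le> d x"
    "A *\<^sub>v f = powers_vec xs d"
proof -
  obtain N where f: "f \<in> poly_vecs xs (length xs)"
    and N: "\<And>l. set l \<subseteq> set xs \<Longrightarrow> length l = N \<Longrightarrow> prod_list (map Var l) \<in> generated_ideal xs f"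
    using assms by (auto simp: residue_defined_def)
  have dim: "dim_vec f = length xs" using f by (auto simp: poly_vecs_def)
  have "\<exists>a \<in> carrier_vec (length xs). a \<bullet> f = Var x ^ Suc N" if x: "x \<in> set xs" for x
  proof -
    have "Var x ^ N \<in> generated_ideal xs f"
      using N[of "replicate N x"] x by (simp add: set_replicate_conv_if)
    \<comment> \<open>The additional factor keeps the exponent positive also when \<open>N\<close>
      is 0.\<close>
    then have "Var x * Var x ^ N \<in> generated_ideal xs f"
      using x by (intro generated_ideal_mult) auto
    then show ?thesis by (auto simp: generated_ideal_def dim poly_vecs_def)
  qed
  then obtain a where a: "\<And>x. x \<in> set xs \<Longrightarrow> a x \<in> carrier_vec (length xs)"
    "\<And>x. x \<in> set xs \<Longrightarrow> a x \<bullet> f = Var x ^ Suc N"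
    by metis
  let ?A = "mat\<^sub>r (length xs) (length xs) (\<lambda>i. a (xs ! i))"
  have "?A *\<^sub>v f = powers_vec xs (\<lambda>_. Suc N)"
    by (rule eq_vecI) (simp_all add: a row_mat_of_row_fun)
  then show ?thesis by (intro that[of ?A "\<lambda>_. Suc N"]) auto
qed

text \<open>(F3) carries \<open>f\<close> to powers of the variables and (F2) then reads off a
  coefficient, so a residue symbol has no other candidate value. The pair of \<open>A\<close> and
  \<open>d\<close> is chosen arbitrarily; \<open>power_residue_eq\<close> removes the
  choice.\<close>

definition power_residue ::
    "'v list \<Rightarrow> ('v, 'k::comm_ring_1) mpoly \<Rightarrow> ('v, 'k) mpoly vec \<Rightarrow> 'k" where
  "power_residue xs h f =
     (let (A, d) = (SOME (A, d). A \<in> carrier_mat (length xs) (length xs) \<and>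
        (\<forall>x \<in> set xs. 1 \<le> d x) \<and> A *\<^sub>v f = powers_vec xs d)
      in Poly_Mapping.lookup (h * det A) (top_mono xs d))"

lemma power_residue_eq:
  assumes xs: "distinct xs" and f: "f \<in> carrier_vec (length xs)"
    and A: "A \<in> carrier_mat (length xs) (length xs)" "\<forall>x \<in> set xs. 1 \<le> d x"
      "A *\<^sub>v f = powers_vec xs d"
  shows "power_residue xs h f = Poly_Mapping.lookup (h * det A) (top_mono xs d)"
proof -
  let ?P = "\<lambda>(A, d). A \<in> carrier_mat (length xs) (length xs) \<and>
        (\<forall>x \<in> set xs. 1 \<le> d x) \<and> A *\<^sub>v f = powers_vec xs d"
  obtain B e where Be: "(SOME x. ?P x) = (B, e)" by (cases "SOME x. ?P x")
  have "?P (SOME x. ?P x)" by (rule someI[of ?P "(A, d)"]) (use A in simp)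
  then have B: "B \<in> carrier_mat (length xs) (length xs)" "\<forall>x \<in> set xs. 1 \<le> e x"
      "B *\<^sub>v f = powers_vec xs e"
    unfolding Be by auto
  show ?thesis
    using lookup_det_unique[OF xs refl f B(1,3) A(1,3) B(2) A(2)]
    unfolding power_residue_def Be by simp
qed

lemma residue_symbol_power_residue:
  fixes xs :: "'v list"
  assumes xs: "distinct xs"
  shows "residue_symbol xs (power_residue xs ::
           ('v, 'k::comm_ring_1) mpoly \<Rightarrow> ('v, 'k) mpoly vec \<Rightarrow> 'k)"
  unfolding residue_symbol_def
proof (intro conjI allI impI ballI)
  fix f :: "('v, 'k) mpoly vec"
  assume f: "residue_defined xs f"
  then have fc: "f \<in> carrier_vec (length xs)"
    by (auto simp: residue_defined_def poly_vecs_def)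
  obtain A d where A: "A \<in> carrier_mat (length xs) (length xs)" "\<forall>x \<in> set xs. 1 \<le> d x"
    "A *\<^sub>v f = powers_vec xs d"
    using residue_defined_powers[OF f] by blast
  note eq = power_residue_eq[OF xs fc A]
  show "power_residue xs (h + h') f = power_residue xs h f + power_residue xs h' f" for h h'
    by (simp add: eq distrib_right lookup_add)
  show "power_residue xs (Const c * h) f = c * power_residue xs h f" for c h
    by (simp add: eq mult.assoc lookup_Const_mult)
  show "power_residue xs h f = 0" if h: "h \<in> generated_ideal xs f" for h
  proof -
    obtain a where a: "h = a \<bullet> f" "a \<in> carrier_vec (length xs)"
      using h fc by (auto simp: generated_ideal_def poly_vecs_def)
    \<comment> \<open>Cramer's rule for (F1): \<open>det A\<close> times \<open>f\<close> is a
      combination of the powers in \<open>powers_vec xs d\<close>, so the top coefficient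
      vanishes.\<close>
    have "h * det A = a \<bullet> (det A \<cdot>\<^sub>v f)"
      using a fc by simp
    also have "\<dots> = a \<bullet> (adj_mat A *\<^sub>v powers_vec xs d)"
      using adj_mat_mult_vec[OF A(1) fc] by (simp add: A(3))
    also have "\<dots> \<in> powers_ideal (set xs) d"
      unfolding scalar_prod_def
      by (intro powers_ideal_sum powers_ideal_mult mult_mat_vec_in_powers_ideal[of _ "length xs" "length xs"])
         (use adj_mat(1)[OF A(1)] in \<open>auto simp: Var_power_in_powers_ideal\<close>)
    finally have "Poly_Mapping.lookup (h * det A) (top_mono xs d) = 0"
      by (rule lookup_powers_ideal) (use A(2) in \<open>force simp: lookup_top_mono\<close>)
    then show ?thesis by (simp add: eq)
  qed
next
  fix d :: "'v \<Rightarrow> nat" and h :: "('v, 'k) mpoly"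
  assume "\<forall>x \<in> set xs. d x \<ge> 1"
  then show "power_residue xs h (vec_of_list (map (\<lambda>x. Var x ^ d x) xs)) =
        Poly_Mapping.lookup h (\<Sum>x \<in> set xs. Poly_Mapping.single x (d x - 1))"
    unfolding powers_vec_def[symmetric] top_mono_def[symmetric]
    using power_residue_eq[OF xs, of "powers_vec xs d" "1\<^sub>m (length xs)" d h] by simp
next
  fix f :: "('v, 'k) mpoly vec" and M and h :: "('v, 'k) mpoly"
  assume *: "residue_defined xs f \<and> M \<in> poly_mats xs (length xs) \<and> residue_defined xs (M *\<^sub>v f)"
  then have f: "f \<in> carrier_vec (length xs)" and M: "M \<in> carrier_mat (length xs) (length xs)"
    by (auto simp: residue_defined_def poly_vecs_def poly_mats_def)
  obtain A d where A: "A \<in> carrier_mat (length xs) (length xs)" "\<forall>x \<in> set xs. 1 \<le> d x"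
    "A *\<^sub>v (M *\<^sub>v f) = powers_vec xs d"
    using residue_defined_powers * by blast
  \<comment> \<open>If \<open>A\<close> takes \<open>M *\<^sub>v f\<close> to powers, then
    \<open>A * M\<close> takes \<open>f\<close> to the same powers; (F3) becomes multiplicativity of
    the determinant.\<close>
  have "power_residue xs h f = Poly_Mapping.lookup (h * det (A * M)) (top_mono xs d)"
    using A M f by (intro power_residue_eq[OF xs f]) (auto simp: assoc_mult_mat_vec)
  moreover have "power_residue xs (h * det M) (M *\<^sub>v f) =
      Poly_Mapping.lookup (h * det M * det A) (top_mono xs d)"
    using A M f by (intro power_residue_eq[OF xs]) auto
  ultimately show "power_residue xs (h * det M) (M *\<^sub>v f) = power_residue xs h f"
    using A(1) M by (simp add: det_mult ac_simps)
qed

lemma residue_symbol_residue: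
  assumes "distinct xs"
  shows "residue_symbol xs (residue xs)"
  unfolding residue_def
  by (rule someI[of "residue_symbol xs"]) (rule residue_symbol_power_residue[OF assms])

subsection \<open>Denominators that divide powers of the variables\<close>

lemma row_in_poly_vecs: "A \<in> poly_mats xs n \<Longrightarrow> i < n \<Longrightarrow> row A i \<in> poly_vecs xs n"
  by (auto simp: poly_mats_def poly_vecs_def)

lemma Var_power_in_generated_ideal:
  assumes A: "A \<in> poly_mats xs (length xs)" and f: "f \<in> carrier_vec (length xs)"
    and Af: "A *\<^sub>v f = powers_vec xs d" and x: "x \<in> set xs"
  shows "Var x ^ d x \<in> generated_ideal xs f"
proof -
  obtain i where i: "i < length xs" "x = xs ! i" using x by (auto simp: in_set_conv_nth)
  have "row A i \<bullet> f = (A *\<^sub>v f) $ i" using A i by (auto simp: poly_mats_def)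
  also have "\<dots> = Var x ^ d x" using i by (simp add: Af)
  finally show ?thesis
    using row_in_poly_vecs[OF A i(1)] f by (force simp: generated_ideal_def)
qed

lemma prod_list_Var_count:
  "prod_list (map Var l) = Var x ^ count_list l x * prod_list (map Var (filter (\<lambda>y. y \<noteq> x) l))"
  by (induction l) (simp_all add: ac_simps)

text \<open>Pigeonhole: among more factors than the sum of the exponents, some variable
  \<open>x\<close> occurs at least \<open>d x\<close> times, and \<open>Var x ^ d x\<close> lies in
  the ideal.\<close>

lemma residue_definedI:
  assumes A: "A \<in> poly_mats xs (length xs)" and f: "f \<in> poly_vecs xs (length xs)"
    and Af: "A *\<^sub>v f = powers_vec xs d"
  shows "residue_defined xs f"
  unfolding residue_defined_def
proof (intro conjI f exI[of _ "Suc (\<Sum>x\<in>set xs. d x)"] allI impI)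
  fix l assume l: "set l \<subseteq> set xs \<and> length l = Suc (\<Sum>x\<in>set xs. d x)"
  have "\<exists>x \<in> set xs. d x \<le> count_list l x"
  proof (rule ccontr)
    assume "\<not> ?thesis"
    then have "(\<Sum>x\<in>set xs. count_list l x) \<le> (\<Sum>x\<in>set xs. d x)"
      by (intro sum_mono) force
    moreover have "(\<Sum>x\<in>set xs. count_list l x) = length l"
      using l by (intro sum_count_set) auto
    ultimately show False using l by simp
  qed
  then obtain x where x: "x \<in> set xs" "d x \<le> count_list l x" by blast
  have "prod_list (map Var l) =
      (Var x ^ (count_list l x - d x) * prod_list (map Var (filter (\<lambda>y. y \<noteq> x) l))) * Var x ^ d x"
  proof -
    have eq: "Var x ^ count_list l x = Var x ^ (count_list l x - d x) * Var x ^ d x"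
      using x(2) by (simp flip: power_add)
    show ?thesis unfolding prod_list_Var_count[of l x] eq by (simp only: ac_simps)
  qed
  also have "\<dots> \<in> generated_ideal xs f"
    using f l x(1)
    by (intro generated_ideal_mult Var_power_in_generated_ideal[OF A _ Af] poly_ring_mult
          poly_ring_power poly_ring_prod_list) (auto simp: poly_vecs_def)
  finally show "prod_list (map Var l) \<in> generated_ideal xs f" .
qed

text \<open>Derived from the axioms of \<open>residue\<close>, not from
  \<open>power_residue\<close>: (F3) with the matrix \<open>A\<close> replaces the denominators by
  powers, where (F2) applies.\<close>

lemma residue_eq_lookup:
  assumes xs: "distinct xs" and A: "A \<in> poly_mats xs (length xs)"
    and f: "f \<in> poly_vecs xs (length xs)"
    and Af: "A *\<^sub>v f = powers_vec xs d" and d: "\<forall>x \<in> set xs. 1 \<le> d x"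
    and h: "h \<in> poly_ring xs" "h * det A \<in> poly_ring xs"
  shows "residue xs h f = Poly_Mapping.lookup (h * det A) (top_mono xs d)"
proof -
  note R = residue_symbol_residue[OF xs, unfolded residue_symbol_def]
  have "powers_vec xs d \<in> poly_vecs xs (length xs)"
    by (auto simp: poly_vecs_def intro!: poly_ring_power)
  then have "residue_defined xs (powers_vec xs d)"
    by (intro residue_definedI[of "1\<^sub>m (length xs)" _ _ d]) (auto simp: poly_mats_def)
  then have "residue xs (h * det A) (A *\<^sub>v f) = residue xs h f"
    using R A residue_definedI[OF A f Af] h(1) unfolding Af by (metis Af)
  moreover have "residue xs (h * det A) (powers_vec xs d) =
      Poly_Mapping.lookup (h * det A) (top_mono xs d)"
    using R h(2) d unfolding powers_vec_def top_mono_def by blast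
  ultimately show ?thesis by (simp add: Af)
qed

lemma residue_add:
  assumes "distinct xs" "residue_defined xs f" "h \<in> poly_ring xs" "h' \<in> poly_ring xs"
  shows "residue xs (h + h') f = residue xs h f + residue xs h' f"
  using residue_symbol_residue[OF assms(1)] assms(2-) unfolding residue_symbol_def by blast

text \<open>The monomials with every exponent below \<open>d x\<close> span the quotient: any other
  monomial is divisible by some \<open>Var x ^ d x\<close>, which lies in the ideal.\<close>

lemma finite_quotient:
  fixes f :: "('v, 'k::comm_ring_1) mpoly vec"
  assumes A: "A \<in> poly_mats xs (length xs)" and f: "f \<in> carrier_vec (length xs)"
    and Af: "A *\<^sub>v f = powers_vec xs d"
  shows "\<exists>B. finite B \<and> B \<subseteq> poly_ring xs \<and>
    (\<forall>p \<in> poly_ring xs. \<exists>c. p - (\<Sum>b\<in>B. Const (c b) * b) \<in> generated_ideal xs f)"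
proof -
  define N :: "('v \<Rightarrow>\<^sub>0 nat) set" where
    "N = {m. Poly_Mapping.keys m \<subseteq> set xs \<and> (\<forall>x \<in> set xs. Poly_Mapping.lookup m x < d x)}"
  let ?m = "\<lambda>m. Poly_Mapping.single m 1 :: ('v, 'k) mpoly"
  have "Poly_Mapping.lookup m x < Max (d ` set xs)" if "m \<in> N" "x \<in> set xs" for m x
    by (rule less_le_trans[of _ "d x"]) (use that in \<open>auto simp: N_def\<close>)
  then have "Poly_Mapping.lookup ` N \<subseteq> {g. \<forall>x. (x \<in> set xs \<longrightarrow> g x \<in> {..<Max (d ` set xs)}) \<and> (x \<notin> set xs \<longrightarrow> g x = 0)}"
    by (auto simp: N_def in_keys_iff)
  then have "finite (Poly_Mapping.lookup ` N)"
    by (rule finite_subset) (rule finite_set_of_finite_funs; simp)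
  then have N: "finite N"
    by (rule finite_imageD) (auto intro!: inj_onI poly_mapping_eqI)
  have inj: "inj_on ?m N"
    by (rule inj_onI) (drule arg_cong[of _ _ Poly_Mapping.keys], simp)
  show ?thesis
  proof (intro exI[of _ "?m ` N"] conjI ballI)
    show "?m ` N \<subseteq> poly_ring xs"
      by (auto simp: N_def intro!: poly_ring_single)
    fix p :: "('v, 'k) mpoly" assume p: "p \<in> poly_ring xs"
    \<comment> \<open>Coefficients are indexed by the spanning elements themselves, hence the
      inverse of the injection of monomials into polynomials.\<close>
    let ?c = "\<lambda>b. Poly_Mapping.lookup p (inv_into N ?m b)"
    let ?K = "Poly_Mapping.keys p"
    let ?t = "\<lambda>m. Poly_Mapping.single m (Poly_Mapping.lookup p m)"
    have "(\<Sum>b\<in>?m ` N. Const (?c b) * b) = sum ?t N"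
      by (subst sum.reindex[OF inj]) (auto intro!: sum.cong simp: inv_into_f_f[OF inj] Const_def mult_single)
    also have "\<dots> = sum ?t (N \<inter> ?K)"
      by (rule sum.mono_neutral_right) (use N in \<open>auto simp: in_keys_iff\<close>)
    finally have 1: "(\<Sum>b\<in>?m ` N. Const (?c b) * b) = sum ?t (?K \<inter> N)"
      by (simp add: Int_commute)
    have "p = sum ?t ?K" by (simp add: poly_mapping_sum_single)
    also have "\<dots> = sum ?t (?K \<inter> N) + sum ?t (?K - N)"
      by (rule sum.Int_Diff) simp
    finally have 2: "p - (\<Sum>b\<in>?m ` N. Const (?c b) * b) = sum ?t (?K - N)"
      unfolding 1 by (simp add: algebra_simps)
    have "sum ?t (?K - N) \<in> generated_ideal xs f"
    proof (rule generated_ideal_sum)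
      fix m assume m: "m \<in> ?K - N"
      then have k: "Poly_Mapping.keys m \<subseteq> set xs" using p by (auto simp: poly_ring_def)
      then obtain x where x: "x \<in> set xs" "d x \<le> Poly_Mapping.lookup m x"
        using m by (force simp: N_def not_less)
      have "?t m = Poly_Mapping.single (m - Poly_Mapping.single x (d x)) (Poly_Mapping.lookup p m) * Var x ^ d x"
        using add_diff_single[OF x(2)] by (simp add: Var_power mult_single)
      also have "\<dots> \<in> generated_ideal xs f"
        using k by (intro generated_ideal_mult Var_power_in_generated_ideal[OF A f Af x(1)] poly_ring_single)
           (auto simp: in_keys_iff lookup_minus subset_iff)
      finally show "?t m \<in> generated_ideal xs f" .
    qed
    then show "\<exists>c. p - (\<Sum>b\<in>?m ` N. Const (c b) * b) \<in> generated_ideal xs f"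
      unfolding 2[symmetric] by (intro exI[of _ ?c])
  qed (use N in simp)
qed

text \<open>No element of the ideal has a constant term, while 1 has one.\<close>

lemma generated_ideal_proper:
  fixes f :: "('v, 'k::comm_ring_1) mpoly vec"
  assumes "\<And>i. i < dim_vec f \<Longrightarrow> f $ i \<in> powers_ideal S (\<lambda>_. 1)"
  shows "generated_ideal xs f \<noteq> poly_ring xs"
proof
  assume "generated_ideal xs f = poly_ring xs"
  then have "1 \<in> generated_ideal xs f" by simp
  then obtain a where "1 = a \<bullet> f" by (auto simp: generated_ideal_def)
  also have "\<dots> \<in> powers_ideal S (\<lambda>_. 1)"
    unfolding scalar_prod_def by (intro powers_ideal_sum powers_ideal_mult assms) simp
  finally have "Poly_Mapping.lookup (1 :: ('v, 'k) mpoly) 0 = 0"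
    by (rule lookup_powers_ideal) simp
  then show False by simp
qed

subsection \<open>Parameters\<close>

lemma lookup_restrict_mono:
  "Poly_Mapping.lookup (restrict_mono A m) x = (if x \<in> A then Poly_Mapping.lookup m x else 0)"
  by (simp add: restrict_mono_def lookup_mapp when_def in_keys_iff)

lemma restrict_mono_eq_0: "restrict_mono (- A) m = 0 \<longleftrightarrow> Poly_Mapping.keys m \<subseteq> A"
  by (auto simp: poly_mapping_eq_iff fun_eq_iff lookup_restrict_mono in_keys_iff)

lemma restrict_mono_id: "Poly_Mapping.keys m \<subseteq> A \<Longrightarrow> restrict_mono A m = m"
  by (rule poly_mapping_eqI) (auto simp: lookup_restrict_mono in_keys_iff)

lemma residue_sum:
  assumes "distinct xs" "residue_defined xs f" "\<And>i. i \<in> I \<Longrightarrow> g i \<in> poly_ring xs"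
  shows "residue xs (sum g I) f = (\<Sum>i\<in>I. residue xs (g i) f)"
proof -
  have 0: "residue xs 0 f = 0"
    using residue_add[OF assms(1,2), of 0 0] by simp
  show ?thesis
    using assms(3) by (induction I rule: infinite_finite_induct)
      (simp_all add: 0 residue_add[OF assms(1,2)] poly_ring_sum)
qed

lemma residue_Const_mult:
  assumes "distinct xs" "residue_defined xs f" "h \<in> poly_ring xs"
  shows "residue xs (Const c * h) f = c * residue xs h f"
  using residue_symbol_residue[OF assms(1)] assms(2-) unfolding residue_symbol_def by blast

text \<open>
  The parameter-free part of a residue with parameters only sees the parameter-free part of the
  numerator; the remaining monomials lie in the ideal generated by the parameters.
\<close>

lemma lookup_param_residue_0:
  assumes xs: "distinct xs" and f: "residue_defined xs f"
    and p: "p \<in> poly_ring xs" and q: "q \<in> powers_ideal S (\<lambda>_. 1)" and S: "S \<inter> set xs = {}"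
  shows "Poly_Mapping.lookup (param_residue xs (p + q) f) 0 = residue xs p f"
proof -
  let ?K = "Poly_Mapping.keys (p + q)"
  have q0: "Poly_Mapping.lookup q m = 0" if "Poly_Mapping.keys m \<subseteq> set xs" for m
    by (rule lookup_powers_ideal[OF q]) (use that S in \<open>auto simp: in_keys_iff\<close>)
  have sub: "Poly_Mapping.keys p \<subseteq> ?K"
  proof
    fix m assume m: "m \<in> Poly_Mapping.keys p"
    then have "Poly_Mapping.keys m \<subseteq> set xs" using p by (auto simp: poly_ring_def)
    from q0[OF this] m show "m \<in> ?K" by (simp add: in_keys_iff lookup_add)
  qed
  \<comment> \<open>Only monomials with trivial parameter part reach the coefficient at 0, and
    \<open>q\<close> has none of these.\<close>
  have coeff: "Poly_Mapping.lookup (Poly_Mapping.single (restrict_mono (- set xs) m)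
       (Poly_Mapping.lookup (p + q) m *
        residue xs (Poly_Mapping.single (restrict_mono (set xs) m) 1) f)) 0 =
     (if m \<in> Poly_Mapping.keys p
      then Poly_Mapping.lookup p m * residue xs (Poly_Mapping.single m 1) f else 0)"
    if "m \<in> ?K" for m
  proof (cases "Poly_Mapping.keys m \<subseteq> set xs")
    case True
    then show ?thesis
      using that restrict_mono_eq_0[of "set xs" m]
      by (simp add: restrict_mono_id q0 lookup_add in_keys_iff)
  next
    case False
    then have "m \<notin> Poly_Mapping.keys p" using p by (auto simp: poly_ring_def)
    then show ?thesis
      using False restrict_mono_eq_0[of "set xs" m] by (simp add: lookup_single when_def)
  qed
  have "Poly_Mapping.lookup (param_residue xs (p + q) f) 0 =
      (\<Sum>m\<in>?K. if m \<in> Poly_Mapping.keys p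
        then Poly_Mapping.lookup p m * residue xs (Poly_Mapping.single m 1) f else 0)"
    unfolding param_residue_def lookup_sum by (rule sum.cong[OF refl coeff])
  also have "\<dots> = (\<Sum>m\<in>Poly_Mapping.keys p.
      Poly_Mapping.lookup p m * residue xs (Poly_Mapping.single m 1) f)"
    using sub by (simp flip: sum.inter_restrict add: Int_absorb1)
  also have "\<dots> = (\<Sum>m\<in>Poly_Mapping.keys p.
      residue xs (Poly_Mapping.single m (Poly_Mapping.lookup p m)) f)"
  proof (rule sum.cong[OF refl])
    fix m assume "m \<in> Poly_Mapping.keys p"
    then have "Poly_Mapping.single m 1 \<in> poly_ring xs"
      using p by (auto simp: poly_ring_def)
    from residue_Const_mult[OF xs f this, of "Poly_Mapping.lookup p m"]
    show "Poly_Mapping.lookup p m * residue xs (Poly_Mapping.single m 1) f =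
        residue xs (Poly_Mapping.single m (Poly_Mapping.lookup p m)) f"
      by (simp add: Const_def mult_single)
  qed
  also have "\<dots> = residue xs p f"
    by (subst residue_sum[OF xs f, symmetric])
       (use p in \<open>auto simp: poly_mapping_sum_single poly_ring_def\<close>)
  finally show ?thesis .
qed

subsection \<open>Partial derivatives\<close>

lemma partial_eq_sum:
  assumes "finite K" "Poly_Mapping.keys p \<subseteq> K"
  shows "partial x p = (\<Sum>m\<in>K. Poly_Mapping.single (m - Poly_Mapping.single x 1)
       (of_nat (Poly_Mapping.lookup m x) * Poly_Mapping.lookup p m))"
  unfolding partial_def
  by (rule sum.mono_neutral_left) (use assms in \<open>auto simp: in_keys_iff\<close>)

lemma partial_add: "partial x (p + q) = partial x p + partial x q"
proof -
  let ?K = "Poly_Mapping.keys p \<union> Poly_Mapping.keys q"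
  have "Poly_Mapping.keys (p + q) \<subseteq> ?K" by (rule keys_add)
  then show ?thesis
    by (simp add: partial_eq_sum[of ?K] lookup_add distrib_left single_add sum.distrib)
qed

lemma partial_single:
  "partial x (Poly_Mapping.single m c) =
     Poly_Mapping.single (m - Poly_Mapping.single x 1) (of_nat (Poly_Mapping.lookup m x) * c)"
  by (subst partial_eq_sum[of "{m}"]) auto

lemma partial_0 [simp]: "partial x 0 = 0"
  by (simp add: partial_def)

lemma partial_Const [simp]: "partial x (Const c) = 0"
  by (simp add: Const_def partial_single)

lemma partial_1 [simp]: "partial x 1 = 0"
  using partial_Const[of x 1] by simp

lemma partial_numeral [simp]: "partial x (numeral n) = 0"
  using partial_Const[of x "numeral n"] by simp

lemma partial_Var [simp]: "partial x (Var y) = (if x = y then 1 else 0)"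
  by (auto simp: Var_def partial_single lookup_single when_def)

lemma partial_uminus: "partial x (- p) = - partial x p"
  using partial_add[of x p "- p"] by (simp add: add_eq_0_iff)

lemma partial_diff: "partial x (p - q) = partial x p - partial x q"
  using partial_add[of x p "- q"] by (simp add: partial_uminus)

text \<open>Since subtraction of exponents is truncated, the exponents match only if
  \<open>x\<close> occurs in the differentiated factor; otherwise the coefficient
  \<open>of_nat 0\<close> removes the term.\<close>

lemma partial_mult_single:
  "partial x (Poly_Mapping.single m c * Poly_Mapping.single n d) =
     partial x (Poly_Mapping.single m c) * Poly_Mapping.single n d +
     Poly_Mapping.single m c * partial x (Poly_Mapping.single n d)"
proof -
  let ?e = "Poly_Mapping.single x (1::nat)"
  have 1: "m - ?e + n = m + n - ?e" if "Poly_Mapping.lookup m x \<noteq> 0"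
    by (rule poly_mapping_eqI)
       (use that in \<open>auto simp: lookup_add lookup_minus lookup_single when_def\<close>)
  have 2: "m + (n - ?e) = m + n - ?e" if "Poly_Mapping.lookup n x \<noteq> 0"
    by (rule poly_mapping_eqI)
       (use that in \<open>auto simp: lookup_add lookup_minus lookup_single when_def\<close>)
  show ?thesis
    using 1 2 by (cases "Poly_Mapping.lookup m x = 0"; cases "Poly_Mapping.lookup n x = 0")
      (simp_all add: mult_single partial_single lookup_add algebra_simps flip: single_add)
qed

lemma partial_mult: "partial x (p * q) = partial x p * q + p * partial x q"
proof (induction p rule: poly_mapping_induct)
  case (single m c)
  show ?case
  proof (induction q rule: poly_mapping_induct)
    case (single n d)
    show ?case by (rule partial_mult_single)
  qed (simp_all add: distrib_left partial_add algebra_simps)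
qed (simp_all add: distrib_right partial_add algebra_simps)

lemma partial_power:
  "partial x (p ^ n) = of_nat n * p ^ (n - 1) * partial x p"
proof (induction n)
  case (Suc n)
  then show ?case
    by (cases n) (simp_all add: partial_mult algebra_simps)
qed simp

lemmas partial_simps =
  partial_add partial_diff partial_uminus partial_mult partial_power

lemma partial_in_poly_ring: "p \<in> poly_ring xs \<Longrightarrow> partial x p \<in> poly_ring xs"
  unfolding partial_def
  by (intro poly_ring_sum poly_ring_single)
     (force simp: poly_ring_def in_keys_iff lookup_minus)

subsection \<open>Graded pieces\<close>

lemma mono_deg_eq_sum:
  assumes "finite K" "Poly_Mapping.keys m \<subseteq> K"
  shows "mono_deg wt m = (\<Sum>x\<in>K. of_nat (Poly_Mapping.lookup m x) * wt x)"
  unfolding mono_deg_def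
  by (rule sum.mono_neutral_left) (use assms in \<open>auto simp: in_keys_iff\<close>)

lemma mono_deg_single: "mono_deg wt (Poly_Mapping.single x n) = of_nat n * wt x"
  by (simp add: mono_deg_eq_sum[of "{x}"])

lemma mono_deg_add: "mono_deg wt (m + n) = mono_deg wt m + mono_deg wt n"
  by (simp add: mono_deg_eq_sum[of "Poly_Mapping.keys m \<union> Poly_Mapping.keys n"] keys_add_nat
      lookup_add distrib_right sum.distrib)

lemma graded_part_0 [simp]: "0 \<in> graded_part wt xs q"
  by (simp add: graded_part_def)

lemma graded_part_poly_ring: "p \<in> graded_part wt xs q \<Longrightarrow> p \<in> poly_ring xs"
  by (simp add: graded_part_def)

lemma graded_part_single:
  assumes "Poly_Mapping.keys m \<subseteq> set xs" "mono_deg wt m = q"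
  shows "Poly_Mapping.single m c \<in> graded_part wt xs q"
  using assms by (auto simp: graded_part_def poly_ring_single)

lemma graded_part_add:
  "p \<in> graded_part wt xs d \<Longrightarrow> q \<in> graded_part wt xs d \<Longrightarrow> p + q \<in> graded_part wt xs d"
  using keys_add[of p q] by (auto simp: graded_part_def poly_ring_add)

lemma graded_part_uminus: "p \<in> graded_part wt xs d \<Longrightarrow> - p \<in> graded_part wt xs d"
  by (auto simp: graded_part_def poly_ring_uminus)

lemma graded_part_diff:
  "p \<in> graded_part wt xs d \<Longrightarrow> q \<in> graded_part wt xs d \<Longrightarrow> p - q \<in> graded_part wt xs d"
  using graded_part_add[OF _ graded_part_uminus, of p wt xs d q] by simp

lemma graded_part_sum:
  "(\<And>i. i \<in> I \<Longrightarrow> g i \<in> graded_part wt xs d) \<Longrightarrow> sum g I \<in> graded_part wt xs d"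
  by (induction I rule: infinite_finite_induct) (simp_all add: graded_part_add)

lemma graded_part_mult:
  assumes "p \<in> graded_part wt xs d" "q \<in> graded_part wt xs e"
  shows "p * q \<in> graded_part wt xs (d + e)"
proof -
  have "mono_deg wt m = d + e" if m: "m \<in> Poly_Mapping.keys (p * q)" for m
  proof -
    obtain a b where "m = a + b" "a \<in> Poly_Mapping.keys p" "b \<in> Poly_Mapping.keys q"
      using keys_mult[of p q] m by blast
    with assms show ?thesis by (simp add: graded_part_def mono_deg_add)
  qed
  with assms show ?thesis by (auto simp: graded_part_def poly_ring_mult)
qed

subsection \<open>Criteria for matrix factorizations\<close>

lemma mult_mat_vec_in_poly_vecs:
  assumes "D \<in> poly_mats vs n" "v \<in> poly_vecs vs n"
  shows "D *\<^sub>v v \<in> poly_vecs vs n"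
  using assms by (auto simp: poly_mats_def poly_vecs_def scalar_prod_def
      intro!: poly_ring_sum poly_ring_mult)

lemma odd_mapI:
  fixes D :: "('v, 'k::comm_ring_1) mpoly mat"
  assumes D: "D \<in> poly_mats vs (r + s)"
    and even: "\<And>i j. i < r \<Longrightarrow> j < r \<Longrightarrow> D $$ (i, j) = 0"
    and odd: "\<And>i j. r \<le> i \<Longrightarrow> i < r + s \<Longrightarrow> r \<le> j \<Longrightarrow> j < r + s \<Longrightarrow> D $$ (i, j) = 0"
  shows "odd_map vs r s D"
proof -
  have Dv: "(D *\<^sub>v v) $ i = (\<Sum>j<r + s. D $$ (i, j) * v $ j)"
    if "v \<in> carrier_vec (r + s)" "i < r + s" for i v
    using that D by (auto simp: poly_mats_def scalar_prod_def atLeast0LessThan)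
  show ?thesis
    unfolding odd_map_def
  proof (intro conjI ballI)
    fix v :: "('v, 'k) mpoly vec" assume v: "v \<in> even_part vs r s"
    have "(D *\<^sub>v v) $ i = 0" if "i < r" for i
    proof -
      have "(\<Sum>j<r + s. D $$ (i, j) * v $ j) = 0"
      proof (intro sum.neutral ballI)
        fix j assume "j \<in> {..<r + s}"
        then show "D $$ (i, j) * v $ j = 0"
          using v that even[of i j] by (cases "j < r") (auto simp: even_part_def)
      qed
      then show ?thesis using v that by (simp add: Dv even_part_def poly_vecs_def)
    qed
    then show "D *\<^sub>v v \<in> odd_part vs r s"
      using v mult_mat_vec_in_poly_vecs[OF D] by (auto simp: odd_part_def even_part_def)
  next
    fix v :: "('v, 'k) mpoly vec" assume v: "v \<in> odd_part vs r s"
    have "(D *\<^sub>v v) $ i = 0" if "r \<le> i" "i < r + s" for i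
    proof -
      have "(\<Sum>j<r + s. D $$ (i, j) * v $ j) = 0"
      proof (intro sum.neutral ballI)
        fix j assume "j \<in> {..<r + s}"
        then show "D $$ (i, j) * v $ j = 0"
          using v that odd[of i j] by (cases "j < r") (auto simp: odd_part_def)
      qed
      then show ?thesis using v that by (simp add: Dv odd_part_def poly_vecs_def)
    qed
    then show "D *\<^sub>v v \<in> even_part vs r s"
      using v mult_mat_vec_in_poly_vecs[OF D] by (auto simp: odd_part_def even_part_def)
  qed
qed

text \<open>Entry (i, j) maps T(n_j) to T(n_i), whose parts of degree q are T in degrees n_j + q and
  n_i + q; the shifts therefore enter as n_i - n_j.\<close>

lemma quasi_homogeneous_mapI:
  fixes D :: "('v, 'k::comm_ring_1) mpoly mat"
  assumes D: "D \<in> carrier_mat (length ns) (length ns)"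
    and deg: "\<And>i j. i < length ns \<Longrightarrow> j < length ns \<Longrightarrow>
      D $$ (i, j) \<in> graded_part wt vs (ns ! i - ns ! j + d)"
  shows "quasi_homogeneous_map wt vs ns d D"
  unfolding quasi_homogeneous_map_def
proof (intro allI ballI)
  fix q and v :: "('v, 'k) mpoly vec"
  assume v: "v \<in> module_part wt vs ns q"
  have "(D *\<^sub>v v) $ i \<in> graded_part wt vs (ns ! i + (q + d))" if i: "i < length ns" for i
  proof -
    have "D $$ (i, j) * v $ j \<in> graded_part wt vs (ns ! i + (q + d))" if j: "j < length ns" for j
    proof -
      have "v $ j \<in> graded_part wt vs (ns ! j + q)"
        using v j by (simp add: module_part_def)
      from graded_part_mult[OF deg[OF i j] this] show ?thesis by (simp add: algebra_simps)
    qed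
    then show ?thesis
      using D v i by (auto simp: module_part_def scalar_prod_def intro!: graded_part_sum)
  qed
  then show "D *\<^sub>v v \<in> module_part wt vs ns (q + d)"
    using D v by (auto simp: module_part_def)
qed

subsection \<open>Koszul matrix factorizations with three factors\<close>

text \<open>
  The endomorphism \<open>\<Sum>i. p\<^sub>i e\<^sub>i \<and> _ + q\<^sub>i \<iota>\<^sub>i\<close> of the exterior algebra on \<open>e\<^sub>1, e\<^sub>2, e\<^sub>3\<close>, in the basis
  \<open>1, e\<^sub>1\<^sub>2, e\<^sub>1\<^sub>3, e\<^sub>2\<^sub>3, e\<^sub>1, e\<^sub>2, e\<^sub>3, e\<^sub>1\<^sub>2\<^sub>3\<close>.
\<close>

definition koszul_mat :: "'a \<Rightarrow> 'a \<Rightarrow> 'a \<Rightarrow> 'a \<Rightarrow> 'a \<Rightarrow> 'a \<Rightarrow> 'a::comm_ring_1 mat" where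
  "koszul_mat p1 q1 p2 q2 p3 q3 = mat_of_rows_list 8
    [[0, 0, 0, 0, q1, q2, q3, 0],
     [0, 0, 0, 0, - p2, p1, 0, q3],
     [0, 0, 0, 0, - p3, 0, p1, - q2],
     [0, 0, 0, 0, 0, - p3, p2, q1],
     [p1, - q2, - q3, 0, 0, 0, 0, 0],
     [p2, q1, 0, - q3, 0, 0, 0, 0],
     [p3, 0, q1, q2, 0, 0, 0, 0],
     [0, p3, - p2, p1, 0, 0, 0, 0]]"

lemma all_less_8:
  "(\<forall>i<8::nat. P i) \<longleftrightarrow> P 0 \<and> P 1 \<and> P 2 \<and> P 3 \<and> P 4 \<and> P 5 \<and> P 6 \<and> P 7"
proof -
  have "{..<8::nat} = {0, 1, 2, 3, 4, 5, 6, 7}" by auto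
  then show ?thesis by (metis (no_types, lifting) insertE insertI1 insertI2 lessThan_iff emptyE)
qed

lemma upt_8: "[0..<8] = [0, 1, 2, 3, 4, 5, 6, 7]"
  by (simp add: upt_rec)

lemma koszul_mat_carrier [simp]: "koszul_mat p1 q1 p2 q2 p3 q3 \<in> carrier_mat 8 8"
  by (intro carrier_matI) (simp_all add: koszul_mat_def mat_of_rows_list_def)

text \<open>Multiplication on lists of rows lets the simplifier carry out products of explicit
  matrices with symbolic entries.\<close>

lemma mat_of_rows_list_mult_8:
  assumes "length R = 8" "length S = 8"
  shows "mat_of_rows_list 8 R * mat_of_rows_list 8 S =
    mat_of_rows_list 8 (map (\<lambda>r. map (\<lambda>j. \<Sum>k\<leftarrow>[0..<8]. r ! k * S ! k ! j) [0..<8]) R)"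
  using assms
  by (intro eq_matI)
     (auto simp: mat_of_rows_list_def scalar_prod_def interv_sum_list_conv_sum_set_nat)

lemma mat_eq_rows_list:
  "mat m n f = mat_of_rows_list n (map (\<lambda>i. map (\<lambda>j. f (i, j)) [0..<n]) [0..<m])"
  by (intro eq_matI) (auto simp: mat_of_rows_list_def)

text \<open>Wedging with e_i and contracting along e_j anticommute for i \<noteq> j, their
  anticommutator is 1 for i = j, and each family anticommutes within itself. Only the products p_i
  q_i survive; the proof checks this entry by entry.\<close>

lemma koszul_mat_square:
  "koszul_mat p1 q1 p2 q2 p3 q3 * koszul_mat p1 q1 p2 q2 p3 q3 =
    (p1 * q1 + p2 * q2 + p3 * q3) \<cdot>\<^sub>m 1\<^sub>m 8"
proof -
  have *: "h \<cdot>\<^sub>m 1\<^sub>m 8 = mat 8 8 (\<lambda>(i, j). if i = j then h else 0)" for h :: 'a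
    by (intro eq_matI) auto
  show ?thesis
    unfolding koszul_mat_def * mat_eq_rows_list
    by (subst mat_of_rows_list_mult_8) (simp_all add: upt_8 algebra_simps)
qed

text \<open>All entries are 0 or parameters up to sign. The case of interest is a partial
  derivative: it keeps the Koszul form.\<close>

lemma map_mat_koszul_mat:
  assumes "f 0 = 0" "\<And>a. f (- a) = - f a"
  shows "map_mat f (koszul_mat p1 q1 p2 q2 p3 q3) =
    koszul_mat (f p1) (f q1) (f p2) (f q2) (f p3) (f q3)"
proof (rule eq_matI)
  have "\<forall>i<8. \<forall>j<8. map_mat f (koszul_mat p1 q1 p2 q2 p3 q3) $$ (i, j) =
    koszul_mat (f p1) (f q1) (f p2) (f q2) (f p3) (f q3) $$ (i, j)"
    unfolding all_less_8 by (simp add: koszul_mat_def mat_of_rows_list_def assms)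
  then show "map_mat f (koszul_mat p1 q1 p2 q2 p3 q3) $$ (i, j) =
    koszul_mat (f p1) (f q1) (f p2) (f q2) (f p3) (f q3) $$ (i, j)"
    if "i < dim_row (koszul_mat (f p1) (f q1) (f p2) (f q2) (f p3) (f q3))"
       "j < dim_col (koszul_mat (f p1) (f q1) (f p2) (f q2) (f p3) (f q3))" for i j
    using that by (simp add: carrier_matD[OF koszul_mat_carrier])
qed (simp_all add: carrier_matD[OF koszul_mat_carrier])

text \<open>The basis element e_I has as shift the sum of d_i - 1 over i in I. Wedging with p_i e_i,
  where p_i has degree d_i, and contracting with q_i, of degree 2 - d_i, then both have degree
  1.\<close>

lemma koszul_matrix_factorization:
  assumes p: "p1 \<in> graded_part wt vs d1" "p2 \<in> graded_part wt vs d2" "p3 \<in> graded_part wt vs d3"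
    and q: "q1 \<in> graded_part wt vs (2 - d1)" "q2 \<in> graded_part wt vs (2 - d2)"
      "q3 \<in> graded_part wt vs (2 - d3)"
  shows "matrix_factorization wt vs (p1 * q1 + p2 * q2 + p3 * q3)
    [0, d1 + d2 - 2, d1 + d3 - 2, d2 + d3 - 2] [d1 - 1, d2 - 1, d3 - 1, d1 + d2 + d3 - 3]
    (koszul_mat p1 q1 p2 q2 p3 q3)" (is "matrix_factorization _ _ _ ?n0 ?n1 ?D")
proof -
  note deg = p q p[THEN graded_part_uminus] q[THEN graded_part_uminus]
  have D: "?D \<in> poly_mats vs (4 + 4)"
  proof -
    have "\<forall>i<8. \<forall>j<8. ?D $$ (i, j) \<in> poly_ring vs"
      unfolding all_less_8
      using deg[THEN graded_part_poly_ring] by (simp add: koszul_mat_def mat_of_rows_list_def)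
    then show ?thesis by (simp add: poly_mats_def)
  qed
  moreover have "odd_map vs 4 4 ?D"
  proof (rule odd_mapI[OF D])
    have *: "\<forall>i<8. \<forall>j<8. (i < 4 \<longleftrightarrow> j < 4) \<longrightarrow> ?D $$ (i, j) = 0"
      unfolding all_less_8 by (simp add: koszul_mat_def mat_of_rows_list_def)
    show "?D $$ (i, j) = 0" if "i < 4" "j < 4" for i j using that * by simp
    show "?D $$ (i, j) = 0" if "4 \<le> i" "i < 4 + 4" "4 \<le> j" "j < 4 + 4" for i j
      using that * by simp
  qed
  moreover have "quasi_homogeneous_map wt vs (?n0 @ ?n1) 1 ?D"
  proof (rule quasi_homogeneous_mapI)
    have "\<forall>i<8. \<forall>j<8. ?D $$ (i, j) \<in> graded_part wt vs ((?n0 @ ?n1) ! i - (?n0 @ ?n1) ! j + 1)"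
      unfolding all_less_8
      using deg by (simp add: koszul_mat_def mat_of_rows_list_def algebra_simps)
    then show "?D $$ (i, j) \<in> graded_part wt vs ((?n0 @ ?n1) ! i - (?n0 @ ?n1) ! j + 1)"
      if "i < length (?n0 @ ?n1)" "j < length (?n0 @ ?n1)" for i j
      using that by simp
  qed (use koszul_mat_carrier in \<open>simp add: numeral_eq_Suc\<close>)
  moreover have "?D * ?D = (p1 * q1 + p2 * q2 + p3 * q3) \<cdot>\<^sub>m 1\<^sub>m (4 + 4)"
    by (simp add: koszul_mat_square)
  moreover have "length ?n0 = 4" "length ?n1 = 4" by simp_all
  ultimately show ?thesis
    unfolding matrix_factorization_def Let_def by metis
qed

lemma supertrace_4_4:
  "supertrace 4 4 A = A $$ (0, 0) + A $$ (1, 1) + A $$ (2, 2) + A $$ (3, 3)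
     - (A $$ (4, 4) + A $$ (5, 5) + A $$ (6, 6) + A $$ (7, 7))"
proof -
  have "{..<4::nat} = {0, 1, 2, 3}" "{4..<4 + 4::nat} = {4, 5, 6, 7}" by auto
  then show ?thesis by (simp add: supertrace_def algebra_simps)
qed

text \<open>
  Up to sign, the supertrace of a product of six Koszul matrices is the determinant of their
  parameters; here the determinant splits into a \<open>4 \<times> 4\<close> and a \<open>2 \<times> 2\<close> block.
\<close>

lemma supertrace_koszul_product:
  "supertrace 4 4
     (koszul_mat x1 x2 0 0 0 0 * (koszul_mat 0 0 0 0 y1 y2 * (koszul_mat 0 z1 z2 z3 0 0 *
      (koszul_mat u1 u2 u3 u4 0 0 * (koszul_mat 0 0 0 0 v1 v2 * koszul_mat 0 0 w1 w2 0 0))))) =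
   (y2 * v1 - y1 * v2) *
     (x1 * (z1 * (u3 * w2 - u4 * w1) - u2 * (z2 * w2 - z3 * w1)) + x2 * u1 * (z2 * w2 - z3 * w1))"
  unfolding koszul_mat_def
  by (simp add: mat_of_rows_list_mult_8 upt_8)
     (simp add: supertrace_4_4 mat_of_rows_list_def algebra_simps)

subsection \<open>A criterion for potentials\<close>

lemma gradient_in_poly_vecs:
  "f \<in> poly_ring xs \<Longrightarrow> gradient xs f \<in> poly_vecs xs (length xs)"
  by (auto simp: gradient_def poly_vecs_def vec_of_list_index partial_in_poly_ring
      intro!: carrier_vecI)

lemma potentialI:
  assumes xs: "distinct xs" "\<And>x. x \<in> set xs \<Longrightarrow> wt x > 0"
    and f: "f \<in> graded_part wt xs q"
    and A: "A \<in> poly_mats xs (length xs)" "A *\<^sub>v gradient xs f = powers_vec xs d"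
    and partial: "\<And>x. x \<in> set xs \<Longrightarrow> partial x f \<in> powers_ideal S (\<lambda>_. 1)"
  shows "potential wt xs f"
proof -
  have g: "gradient xs f \<in> carrier_vec (length xs)"
    using gradient_in_poly_vecs[OF graded_part_poly_ring[OF f]] by (simp add: poly_vecs_def)
  have "generated_ideal xs (gradient xs f) \<noteq> poly_ring xs"
    by (rule generated_ideal_proper[of _ S])
       (use partial in \<open>auto simp: gradient_def vec_of_list_index\<close>)
  with xs f finite_quotient[OF A(1) g A(2)] show ?thesis
    unfolding potential_def by blast
qed

subsection \<open>Matrices of size three\<close>

lemma all_less_3: "(\<forall>i<3::nat. P i) \<longleftrightarrow> P 0 \<and> P 1 \<and> P 2"
proof -
  have "{..<3::nat} = {0, 1, 2}" by auto
  then show ?thesis by (metis (no_types, lifting) insertE insertI1 insertI2 lessThan_iff emptyE)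
qed

lemma mat_3_mult_vec:
  "mat_of_rows_list 3 [[a11, a12, a13], [a21, a22, a23], [a31, a32, a33]] *\<^sub>v vec_of_list [b1, b2, b3] =
   vec_of_list [a11 * b1 + a12 * b2 + a13 * b3, a21 * b1 + a22 * b2 + a23 * b3,
     a31 * b1 + a32 * b2 + a33 * b3 :: 'a::comm_ring_1]" (is "?l = ?r")
proof (rule eq_vecI)
  have "{0..<3} = {0, 1, 2::nat}" by auto
  then have "\<forall>i<3. ?l $ i = ?r $ i"
    unfolding all_less_3
    by (simp add: mat_of_rows_list_def scalar_prod_def vec_of_list_index add.assoc del: vec_of_list_Cons)
  then show "?l $ i = ?r $ i" if "i < dim_vec ?r" for i
    using that by (simp add: numeral_eq_Suc)
qed (simp add: mat_of_rows_list_def)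

lemma det_2x2:
  fixes A :: "'a::comm_ring_1 mat"
  assumes A: "A \<in> carrier_mat 2 2"
  shows "det A = A $$ (0, 0) * A $$ (1, 1) - A $$ (0, 1) * A $$ (1, 0)"
proof -
  have "{..<2::nat} = {0, 1}" by auto
  moreover have "mat_delete A 0 j \<in> carrier_mat 1 1" for j
    using mat_delete_carrier[OF A] by simp
  ultimately show ?thesis
    using A by (simp add: laplace_expansion_row[OF A, of 0] cofactor_def det_single mat_delete_def)
qed

lemma det_3x3:
  "det (mat_of_rows_list 3 [[a11, a12, a13], [a21, a22, a23], [a31, a32, a33]]) =
    a11 * (a22 * a33 - a23 * a32) - a12 * (a21 * a33 - a23 * a31)
      + a13 * (a21 * a32 - a22 * a31 :: 'a::comm_ring_1)"
proof -
  define A where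
    "A = mat_of_rows_list 3 [[a11, a12, a13], [a21, a22, a23], [a31, a32, a33]]"
  have A: "A \<in> carrier_mat 3 3"
    unfolding A_def by (intro carrier_matI) (simp_all add: mat_of_rows_list_def)
  have "mat_delete A 0 j \<in> carrier_mat 2 2" for j
    using mat_delete_carrier[OF A] by simp
  then have "cofactor A 0 j = (- 1) ^ j * (mat_delete A 0 j $$ (0, 0) * mat_delete A 0 j $$ (1, 1)
      - mat_delete A 0 j $$ (0, 1) * mat_delete A 0 j $$ (1, 0))" for j
    by (simp add: cofactor_def det_2x2)
  moreover have "{..<3::nat} = {0, 1, 2}" by auto
  ultimately have "det A = (\<Sum>j\<in>{0, 1, 2}. A $$ (0, j) *
      ((- 1) ^ j * (mat_delete A 0 j $$ (0, 0) * mat_delete A 0 j $$ (1, 1)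
      - mat_delete A 0 j $$ (0, 1) * mat_delete A 0 j $$ (1, 0))))"
    using laplace_expansion_row[OF A, of 0] by simp
  then show ?thesis
    unfolding A_def by (simp add: mat_delete_def mat_of_rows_list_def algebra_simps)
qed

lemma poly_mats_3I:
  assumes "a11 \<in> poly_ring xs" "a12 \<in> poly_ring xs" "a13 \<in> poly_ring xs"
    "a21 \<in> poly_ring xs" "a22 \<in> poly_ring xs" "a23 \<in> poly_ring xs"
    "a31 \<in> poly_ring xs" "a32 \<in> poly_ring xs" "a33 \<in> poly_ring xs"
  shows "mat_of_rows_list 3 [[a11, a12, a13], [a21, a22, a23], [a31, a32, a33]] \<in> poly_mats xs 3"
    (is "?A \<in> _")
proof -
  have "\<forall>i<3. \<forall>j<3. ?A $$ (i, j) \<in> poly_ring xs"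
    unfolding all_less_3 using assms by (simp add: mat_of_rows_list_def)
  moreover have "?A \<in> carrier_mat 3 3"
    by (intro carrier_matI) (simp_all add: mat_of_rows_list_def)
  ultimately show ?thesis by (simp add: poly_mats_def)
qed

subsection \<open>The potentials\<close>

lemma f_Q18_graded: "f_Q18 \<in> graded_part weight [X, Y, Z] 2"
  unfolding f_Q18_def
  by (intro graded_part_add)
     (auto simp: monomial_simps keys_add_nat mono_deg_add mono_deg_single intro!: graded_part_single)

lemma f_E30_graded: "f_E30 \<in> graded_part weight [U, V, W] 2"
  unfolding f_E30_def
  by (intro graded_part_add)
     (auto simp: monomial_simps keys_add_nat mono_deg_add mono_deg_single intro!: graded_part_single)

lemma gradient_f_Q18:
  "gradient [X, Y, Z] f_Q18 =
     vec_of_list [8 * Var X ^ 7 + Var Z ^ 2, 3 * Var Y ^ 2, 2 * (Var X * Var Z)]"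
  by (simp add: gradient_def f_Q18_def partial_simps)

lemma gradient_f_E30:
  "gradient [U, V, W] f_E30 =
     vec_of_list [8 * Var U ^ 7 * Var W, 3 * Var V ^ 2, Var U ^ 8 + 2 * Var W]"
  by (simp add: gradient_def f_E30_def partial_simps)

text \<open>Matrices that turn the gradients into \<open>(x ^ 8, y ^ 2, z ^ 3)\<close> and \<open>(u ^ 15, v ^ 2, w ^ 2)\<close>.\<close>

definition Q18_mat :: "(variable, 'k::field_char_0) mpoly mat" where
  "Q18_mat = mat_of_rows_list 3
    [[2 * (Const (1/16) * Var X), 0, - (Const (1/16) * Var Z)],
     [0, Const (1/3), 0],
     [Var Z, 0, - (4 * Var X ^ 6)]]"

definition E30_mat :: "(variable, 'k::field_char_0) mpoly mat" where
  "E30_mat = mat_of_rows_list 3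
    [[- (4 * Const (1/16)), 0, Var U ^ 7],
     [0, Const (1/3), 0],
     [- (Const (1/16) * Var U), 0, 8 * (Const (1/16) * Var W)]]"

definition Q18_exponents :: "variable \<Rightarrow> nat" where
  "Q18_exponents = (\<lambda>_. 0)(X := 8, Y := 2, Z := 3)"

definition E30_exponents :: "variable \<Rightarrow> nat" where
  "E30_exponents = (\<lambda>_. 0)(U := 15, V := 2, W := 2)"

lemma Const_16: "16 * Const (1/16 :: 'k::field_char_0) = 1"
  by (simp flip: Const_numeral Const_mult)

lemma Const_3: "3 * Const (1/3 :: 'k::field_char_0) = 1"
  by (simp flip: Const_numeral Const_mult)

lemma Q18_mat_poly: "Q18_mat \<in> poly_mats [X, Y, Z] (length [X, Y, Z])"
proof -
  have "Q18_mat \<in> poly_mats [X, Y, Z] 3"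
    unfolding Q18_mat_def by (intro poly_mats_3I) (auto intro!: poly_ring_intros)
  then show ?thesis by (simp add: numeral_3_eq_3)
qed

lemma E30_mat_poly: "E30_mat \<in> poly_mats [U, V, W] (length [U, V, W])"
proof -
  have "E30_mat \<in> poly_mats [U, V, W] 3"
    unfolding E30_mat_def by (intro poly_mats_3I) (auto intro!: poly_ring_intros)
  then show ?thesis by (simp add: numeral_3_eq_3)
qed

text \<open>Fractions are kept as one unknown \<open>c\<close> with 16 c = 1 or 3 c = 1, which
  leaves identities in a commutative ring.\<close>

lemma Q18_mat_gradient:
  "Q18_mat *\<^sub>v gradient [X, Y, Z] f_Q18 = powers_vec [X, Y, Z] Q18_exponents"
proof -
  have 1: "2 * (c * x) * (8 * x ^ 7 + z ^ 2) + 0 * b + - (c * z) * (2 * (x * z)) = x ^ 8"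
    if "16 * c = 1" for c x z b :: "(variable, 'k::field_char_0) mpoly"
  proof -
    have "2 * (c * x) * (8 * x ^ 7 + z ^ 2) + 0 * b + - (c * z) * (2 * (x * z)) = (16 * c) * x ^ 8"
      by (simp add: algebra_simps eval_nat_numeral)
    then show ?thesis by (simp add: that)
  qed
  have 2: "0 * a + c * (3 * y ^ 2) + 0 * b = y ^ 2"
    if "3 * c = 1" for a b c y :: "(variable, 'k::field_char_0) mpoly"
  proof -
    have "0 * a + c * (3 * y ^ 2) + 0 * b = (3 * c) * y ^ 2"
      by (simp add: algebra_simps)
    then show ?thesis by (simp add: that)
  qed
  have 3: "z * (8 * x ^ 7 + z ^ 2) + 0 * b + - (4 * x ^ 6) * (2 * (x * z)) = z ^ 3"
    for x z b :: "(variable, 'k::field_char_0) mpoly"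
    by (simp add: algebra_simps eval_nat_numeral)
  show ?thesis
    unfolding Q18_mat_def gradient_f_Q18 mat_3_mult_vec 1[OF Const_16] 2[OF Const_3] 3
    by (simp add: powers_vec_def Q18_exponents_def)
qed

lemma E30_mat_gradient:
  "E30_mat *\<^sub>v gradient [U, V, W] f_E30 = powers_vec [U, V, W] E30_exponents"
proof -
  have 1: "- (4 * c) * (8 * u ^ 7 * w) + 0 * b + u ^ 7 * (u ^ 8 + 2 * w) = u ^ 15"
    if "16 * c = 1" for c u w b :: "(variable, 'k::field_char_0) mpoly"
  proof -
    \<comment> \<open>The term u^7 w cancels only because 16 c = 1, so it is split off with the
      factor 1 - 16 c.\<close>
    have "- (4 * c) * (8 * u ^ 7 * w) + 0 * b + u ^ 7 * (u ^ 8 + 2 * w) =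
        u ^ 15 + 2 * (u ^ 7 * w) * (1 - 16 * c)"
      by (simp add: algebra_simps eval_nat_numeral)
    then show ?thesis by (simp add: that)
  qed
  have 2: "0 * a + c * (3 * y ^ 2) + 0 * b = y ^ 2"
    if "3 * c = 1" for a b c y :: "(variable, 'k::field_char_0) mpoly"
  proof -
    have "0 * a + c * (3 * y ^ 2) + 0 * b = (3 * c) * y ^ 2"
      by (simp add: algebra_simps)
    then show ?thesis by (simp add: that)
  qed
  have 3: "- (c * u) * (8 * u ^ 7 * w) + 0 * b + 8 * (c * w) * (u ^ 8 + 2 * w) = w ^ 2"
    if "16 * c = 1" for c u w b :: "(variable, 'k::field_char_0) mpoly"
  proof -
    have "- (c * u) * (8 * u ^ 7 * w) + 0 * b + 8 * (c * w) * (u ^ 8 + 2 * w) = (16 * c) * w ^ 2"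
      by (simp add: algebra_simps eval_nat_numeral)
    then show ?thesis by (simp add: that)
  qed
  show ?thesis
    unfolding E30_mat_def gradient_f_E30 mat_3_mult_vec 1[OF Const_16] 2[OF Const_3] 3[OF Const_16]
    by (simp add: powers_vec_def E30_exponents_def)
qed

lemma potential_f_Q18: "potential weight [X, Y, Z] (f_Q18 :: (variable, 'k::field_char_0) mpoly)"
proof (rule potentialI[OF _ _ f_Q18_graded _ Q18_mat_gradient])
  show "partial x f_Q18 \<in> powers_ideal UNIV (\<lambda>_. 1)" if "x \<in> set [X, Y, Z]" for x
  proof -
    have "8 * Var X ^ 7 + Var Z ^ 2 \<in> powers_ideal UNIV (\<lambda>_. 1)"
      "3 * Var Y ^ 2 \<in> powers_ideal UNIV (\<lambda>_. 1)"
      "2 * (Var X * Var Z) \<in> powers_ideal UNIV (\<lambda>_. 1)"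
      by (intro powers_ideal_intros UNIV_I)+
    then show ?thesis
      using that by (auto simp: f_Q18_def partial_simps algebra_simps)
  qed
qed (use Q18_mat_poly in auto)

lemma potential_f_E30: "potential weight [U, V, W] (f_E30 :: (variable, 'k::field_char_0) mpoly)"
proof (rule potentialI[OF _ _ f_E30_graded _ E30_mat_gradient])
  show "partial x f_E30 \<in> powers_ideal UNIV (\<lambda>_. 1)" if "x \<in> set [U, V, W]" for x
    using that by (auto simp: f_E30_def partial_simps intro: powers_ideal_intros simp del: One_nat_def)
qed (use E30_mat_poly in auto)

text \<open>\<open>det Q18_mat\<close> is z^2/48 - x^7/6. Multiplied by y z^2, which has the top
  degree 29/12 of the Jacobian ring, its second term meets the top monomial x^7 y z^2 and gives
  -c/6.\<close>

lemma residue_Q18: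
  assumes c: "(c :: 'k::field_char_0) \<noteq> 0"
  shows "residue [X, Y, Z] (Const c * (Var Y * Var Z ^ 2)) (gradient [X, Y, Z] f_Q18) \<noteq> 0"
proof -
  let ?h = "Const c * (Var Y * Var Z ^ 2) :: (variable, 'k) mpoly"
  have k: "Const (c / 6) = 8 * Const c * Const (1/16) * Const (1/3)"
    "Const (c / 48) = Const c * Const (1/16) * Const (1/3)"
    by (simp_all only: Const_mult[symmetric] Const_numeral[symmetric]) simp_all
  have hd: "?h * det Q18_mat =
      Const (c / 48) * (Var Y * Var Z ^ 4) - Const (c / 6) * (Var X ^ 7 * Var Y * Var Z ^ 2)"
    unfolding Q18_mat_def det_3x3 k by (simp add: algebra_simps eval_nat_numeral)
  have top: "top_mono [X, Y, Z] Q18_exponents =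
      Poly_Mapping.single X 7 + Poly_Mapping.single Y 1 + Poly_Mapping.single Z 2"
    by (simp add: top_mono_def Q18_exponents_def add.assoc)
  have neq: "Poly_Mapping.single Y 1 + Poly_Mapping.single Z 4 \<noteq>
      Poly_Mapping.single X (7::nat) + Poly_Mapping.single Y 1 + Poly_Mapping.single Z 2"
    by (auto dest!: arg_cong[of _ _ "\<lambda>m. Poly_Mapping.lookup m Z"] simp: lookup_add lookup_single)
  have "residue [X, Y, Z] ?h (gradient [X, Y, Z] f_Q18) =
      Poly_Mapping.lookup (?h * det Q18_mat) (top_mono [X, Y, Z] Q18_exponents)"
  proof (rule residue_eq_lookup)
    show "gradient [X, Y, Z] f_Q18 \<in> poly_vecs [X, Y, Z] (length [X, Y, Z])"
      by (rule gradient_in_poly_vecs[OF graded_part_poly_ring[OF f_Q18_graded]])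
    show "?h * det Q18_mat \<in> poly_ring [X, Y, Z]"
      unfolding hd by (intro poly_ring_intros) simp_all
  qed (use Q18_mat_poly Q18_mat_gradient in \<open>auto simp: Q18_exponents_def intro!: poly_ring_intros\<close>)
  also have "\<dots> = - c / 6"
    using neq unfolding hd top lookup_minus lookup_Const_mult
    by (simp add: monomial_simps lookup_single)
  finally show ?thesis using c by simp
qed

text \<open>\<open>det E30_mat\<close> is u^8/48 - w/24; its second term takes u^14 v to the top
  monomial u^14 v w and gives -c/24.\<close>

lemma residue_E30:
  assumes c: "(c :: 'k::field_char_0) \<noteq> 0"
  shows "residue [U, V, W] (Const c * (Var U ^ 14 * Var V)) (gradient [U, V, W] f_E30) \<noteq> 0"
proof -
  let ?h = "Const c * (Var U ^ 14 * Var V) :: (variable, 'k) mpoly"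
  have k: "Const (c / 24) = 32 * Const c * Const (1/16) * Const (1/16) * Const (1/3)"
    "Const (c / 48) = Const c * Const (1/16) * Const (1/3)"
    by (simp_all only: Const_mult[symmetric] Const_numeral[symmetric]) simp_all
  have hd: "?h * det E30_mat =
      Const (c / 48) * (Var U ^ 22 * Var V) - Const (c / 24) * (Var U ^ 14 * Var V * Var W)"
    unfolding E30_mat_def det_3x3 k by (simp add: algebra_simps eval_nat_numeral)
  have top: "top_mono [U, V, W] E30_exponents =
      Poly_Mapping.single U 14 + Poly_Mapping.single V 1 + Poly_Mapping.single W 1"
    by (simp add: top_mono_def E30_exponents_def add.assoc)
  have neq: "Poly_Mapping.single U 22 + Poly_Mapping.single V 1 \<noteq>
      Poly_Mapping.single U (14::nat) + Poly_Mapping.single V 1 + Poly_Mapping.single W 1"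
    by (auto dest!: arg_cong[of _ _ "\<lambda>m. Poly_Mapping.lookup m U"] simp: lookup_add lookup_single)
  have "residue [U, V, W] ?h (gradient [U, V, W] f_E30) =
      Poly_Mapping.lookup (?h * det E30_mat) (top_mono [U, V, W] E30_exponents)"
  proof (rule residue_eq_lookup)
    show "gradient [U, V, W] f_E30 \<in> poly_vecs [U, V, W] (length [U, V, W])"
      by (rule gradient_in_poly_vecs[OF graded_part_poly_ring[OF f_E30_graded]])
    show "?h * det E30_mat \<in> poly_ring [U, V, W]"
      unfolding hd by (intro poly_ring_intros) simp_all
  qed (use E30_mat_poly E30_mat_gradient in \<open>auto simp: E30_exponents_def intro!: poly_ring_intros\<close>)
  also have "\<dots> = - c / 24"
    using neq unfolding hd top lookup_minus lookup_Const_mult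
    by (simp add: monomial_simps lookup_single)
  finally show ?thesis using c by simp
qed

subsection \<open>The matrix factorization\<close>

definition scaled_U :: "'k \<Rightarrow> (variable, 'k::field_char_0) mpoly" where
  "scaled_U c = Const c * Var U"

definition quintic :: "'k \<Rightarrow> (variable, 'k::field_char_0) mpoly" where
  "quintic c = (let x = Var X; s = scaled_U c in
     x ^ 5 + x ^ 4 * s ^ 2 + x ^ 3 * s ^ 4 + x ^ 2 * s ^ 6 + x * s ^ 8 + s ^ 10)"

text \<open>The h of the overview with its two lowest orders in x split off. Modulo x its derivative
  by x is s^12 and that by u is 14 c s^13, so \<open>quintic\<close> is never differentiated
  explicitly.\<close>

definition septic :: "'k \<Rightarrow> (variable, 'k::field_char_0) mpoly" where
  "septic c = Var X * (Var X * quintic c + scaled_U c ^ 12) + scaled_U c ^ 14"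

definition shifted_W :: "(variable, 'k::field_char_0) mpoly" where
  "shifted_W = Var W + Const (1/2) * Var U ^ 8"

definition orbifold_mat :: "'k \<Rightarrow> (variable, 'k::field_char_0) mpoly mat" where
  "orbifold_mat c = koszul_mat
     (Var X - scaled_U c ^ 2) (Var Z ^ 2 + septic c)
     (scaled_U c * Var Z - shifted_W) (scaled_U c * Var Z + shifted_W)
     (Var Y - Var V) (Var Y ^ 2 + Var Y * Var V + Var V ^ 2)"

lemma septic_telescopes: "(Var X - scaled_U c ^ 2) * septic c = Var X ^ 8 - scaled_U c ^ 16"
  by (simp add: septic_def quintic_def Let_def algebra_simps eval_nat_numeral)

lemma shifted_W_square:
  "(shifted_W :: (variable, 'k::field_char_0) mpoly) ^ 2 =
     Var W ^ 2 + Var U ^ 8 * Var W + Const (1/4) * Var U ^ 16"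
proof -
  have half: "2 * Const (1/2 :: 'k) = 1" "Const (1/2) ^ 2 = Const (1/4 :: 'k)"
    by (simp_all add: power2_eq_square flip: Const_numeral Const_mult)
  have expand: "(w + h * u ^ 8) ^ 2 = w ^ 2 + (2 * h) * (u ^ 8 * w) + h ^ 2 * u ^ 16"
    for w h u :: "(variable, 'k) mpoly"
    by (simp add: algebra_simps eval_nat_numeral)
  show ?thesis
    unfolding shifted_W_def expand half by simp
qed

lemma orbifold_mat_potential:
  assumes "c ^ 16 = - 1 / 4"
  shows "(Var X - scaled_U c ^ 2) * (Var Z ^ 2 + septic c)
     + (scaled_U c * Var Z - shifted_W) * (scaled_U c * Var Z + shifted_W)
     + (Var Y - Var V) * (Var Y ^ 2 + Var Y * Var V + Var V ^ 2) = f_Q18 - f_E30"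
proof -
  have "scaled_U c ^ 16 = - (Const (1/4) * Var U ^ 16)"
    by (simp add: scaled_U_def power_mult_distrib assms Const_uminus flip: Const_power)
  then have s: "(Var X - scaled_U c ^ 2) * septic c = Var X ^ 8 + Const (1/4) * Var U ^ 16"
    by (simp add: septic_telescopes)
  have expand: "(x - s ^ 2) * (z ^ 2 + h) + (s * z - w) * (s * z + w) + (y - v) * (y ^ 2 + y * v + v ^ 2) =
      (x - s ^ 2) * h - w ^ 2 + y ^ 3 - v ^ 3 + x * z ^ 2"
    for x s z h w y v :: "(variable, 'a) mpoly"
    by (simp add: algebra_simps eval_nat_numeral)
  show ?thesis
    unfolding expand s shifted_W_square f_Q18_def f_E30_def by (simp add: algebra_simps)
qed

lemma orbifold_mat_factorization:
  assumes "c ^ 16 = - 1 / 4"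
  obtains ns0 ns1 where "length ns0 = 4" "length ns1 = 4"
    "matrix_factorization weight [X, Y, Z, U, V, W] (f_Q18 - f_E30) ns0 ns1 (orbifold_mat c)"
proof -
  let ?G = "graded_part weight [X, Y, Z, U, V, W]"
  note simps = monomial_simps scaled_U_def power_mult_distrib keys_add_nat mono_deg_add mono_deg_single
  have G: "Var X - scaled_U c ^ 2 \<in> ?G (1/4)"
    "Var Z ^ 2 + septic c \<in> ?G (7/4)"
    "scaled_U c * Var Z - shifted_W \<in> ?G 1"
    "scaled_U c * Var Z + shifted_W \<in> ?G 1"
    "Var Y - Var V \<in> ?G (2/3)"
    "Var Y ^ 2 + Var Y * Var V + Var V ^ 2 \<in> ?G (4/3)"
    unfolding septic_def quintic_def Let_def shifted_W_def distrib_left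
    by (intro graded_part_add graded_part_diff; simp add: simps graded_part_single)+
  \<comment> \<open>The shifts belong to the degrees 1/4, 1 and 2/3 of the first factors of the
    three products.\<close>
  have "matrix_factorization weight [X, Y, Z, U, V, W] (f_Q18 - f_E30)
    [0, 1/4 + 1 - 2, 1/4 + 2/3 - 2, 1 + 2/3 - 2] [1/4 - 1, 1 - 1, 2/3 - 1, 1/4 + 1 + 2/3 - 3]
    (orbifold_mat c)"
    unfolding orbifold_mat_potential[OF assms, symmetric] orbifold_mat_def
    by (rule koszul_matrix_factorization) (use G in simp_all)
  then show ?thesis by (intro that) simp_all
qed

section \<open>Partial derivatives of the six factors, the supertrace and the quantum
  dimensions\<close>

lemma partial_scaled_U: "partial x (scaled_U c) = (if x = U then Const c else 0)"
  by (simp add: scaled_U_def partial_simps)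

lemma partial_quintic: "x \<noteq> X \<Longrightarrow> x \<noteq> U \<Longrightarrow> partial x (quintic c) = 0"
  by (simp add: quintic_def Let_def partial_simps partial_scaled_U)

definition septic_X :: "'k \<Rightarrow> (variable, 'k::field_char_0) mpoly" where
  "septic_X c = Var X * (2 * quintic c + Var X * partial X (quintic c)) + scaled_U c ^ 12"

definition septic_U :: "'k \<Rightarrow> (variable, 'k::field_char_0) mpoly" where
  "septic_U c = Var X * (Var X * partial U (quintic c) + 12 * scaled_U c ^ 11 * Const c)
     + 14 * scaled_U c ^ 13 * Const c"

text \<open>\<open>Y\<close> and \<open>V\<close> occur only in the third pair of factors, the other
  variables only in the first two pairs. These zero patterns make the Jacobian determinant split
  into blocks.\<close>

lemma partial_orbifold_mat:
  "map_mat (partial X) (orbifold_mat c) = koszul_mat 1 (septic_X c) 0 0 0 0"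
  "map_mat (partial Y) (orbifold_mat c) = koszul_mat 0 0 0 0 1 (2 * Var Y + Var V)"
  "map_mat (partial Z) (orbifold_mat c) = koszul_mat 0 (2 * Var Z) (scaled_U c) (scaled_U c) 0 0"
  "map_mat (partial U) (orbifold_mat c) = koszul_mat (- (2 * scaled_U c * Const c)) (septic_U c)
     (Const c * Var Z - Const (1/2) * (8 * Var U ^ 7)) (Const c * Var Z + Const (1/2) * (8 * Var U ^ 7)) 0 0"
  "map_mat (partial V) (orbifold_mat c) = koszul_mat 0 0 0 0 (- 1) (Var Y + 2 * Var V)"
  "map_mat (partial W) (orbifold_mat c) = koszul_mat 0 0 (- 1) 1 0 0"
  by (simp_all add: orbifold_mat_def map_mat_koszul_mat partial_simps partial_scaled_U partial_quintic
      septic_def septic_X_def septic_U_def shifted_W_def algebra_simps)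

lemma supertrace_orbifold_mat:
  "supertrace 4 4 (deriv_product [X, Y, Z, U, V, W] (orbifold_mat c)) =
     - 3 * (Var Y + Var V) * (4 * Const c * Var Z ^ 2
       - 2 * scaled_U c * septic_U c - 4 * Const c * scaled_U c ^ 2 * septic_X c)"
proof -
  have "dim_row (orbifold_mat c) = 8"
    by (simp add: orbifold_mat_def carrier_matD[OF koszul_mat_carrier])
  then have "supertrace 4 4 (deriv_product [X, Y, Z, U, V, W] (orbifold_mat c)) =
    ((2 * Var Y + Var V) * (- 1) - 1 * (Var Y + 2 * Var V)) *
    (1 * (2 * Var Z * ((Const c * Var Z - Const (1/2) * (8 * Var U ^ 7)) * 1 -
       (Const c * Var Z + Const (1/2) * (8 * Var U ^ 7)) * (- 1))
     - septic_U c * (scaled_U c * 1 - scaled_U c * (- 1)))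
     + septic_X c * (- (2 * scaled_U c * Const c)) * (scaled_U c * 1 - scaled_U c * (- 1)))"
    unfolding supertrace_koszul_product[symmetric]
    by (simp add: deriv_product_def partial_orbifold_mat right_mult_one_mat[OF koszul_mat_carrier])
  \<comment> \<open>The two contributions of the u-derivative of \<open>shifted_W\<close> cancel,
    and the block in y and v equals -3 (y + v).\<close>
  also have "\<dots> = - 3 * (Var Y + Var V) * (4 * Const c * Var Z ^ 2
       - 2 * scaled_U c * septic_U c - 4 * Const c * scaled_U c ^ 2 * septic_X c)"
    by (simp add: algebra_simps power2_eq_square)
  finally show ?thesis .
qed

text \<open>At u = v = 0, hence s = 0, the supertrace reduces to -12 c y z^2; the variable w does
  not occur in it.\<close>

lemma qdim_left_orbifold_mat:
  assumes "(c :: 'k::field_char_0) \<noteq> 0"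
  shows "qdim_left [X, Y, Z] f_Q18 [U, V, W] 4 4 (orbifold_mat c) \<noteq> 0"
proof -
  let ?p = "Const (- 12 * c) * (Var Y * Var Z ^ 2)"
  \<comment> \<open>Every summand ends in \<open>Var V\<close> or \<open>Var U\<close>, the form in
    which \<open>powers_ideal_mult\<close> shows membership in the ideal of the parameters.\<close>
  let ?q = "- (12 * Const c * Var Z ^ 2) * Var V + (6 * (Var Y + Var V) *
     (Const c * septic_U c + 2 * Const c * (Const c * scaled_U c) * septic_X c)) * Var U"
  have split: "supertrace 4 4 (deriv_product ([X, Y, Z] @ [U, V, W]) (orbifold_mat c)) = ?p + ?q"
    by (simp add: supertrace_orbifold_mat scaled_U_def Const_mult Const_uminus algebra_simps
        power2_eq_square)
  have q: "?q \<in> powers_ideal {U, V} (\<lambda>_. 1)"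
    by (intro powers_ideal_add powers_ideal_mult Var_in_powers_ideal) simp_all
  have "Poly_Mapping.lookup (qdim_left [X, Y, Z] f_Q18 [U, V, W] 4 4 (orbifold_mat c)) 0 =
      residue [X, Y, Z] ?p (gradient [X, Y, Z] f_Q18)"
    unfolding qdim_left_def split
  proof (rule lookup_param_residue_0[OF _ _ _ q])
    show "residue_defined [X, Y, Z] (gradient [X, Y, Z] (f_Q18 :: (variable, 'k) mpoly))"
      by (rule residue_definedI[OF Q18_mat_poly _ Q18_mat_gradient])
         (rule gradient_in_poly_vecs[OF graded_part_poly_ring[OF f_Q18_graded]])
  qed (auto intro!: poly_ring_intros)
  also have "\<dots> \<noteq> 0" by (rule residue_Q18) (use assms in simp)
  finally show ?thesis by auto
qed

text \<open>At x = y = z = 0 the derivatives of \<open>septic\<close> are s^12 and 14 c s^13, so the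
  supertrace becomes 3 v (28 + 4) c s^14 = 96 c^15 u^14 v.\<close>

lemma qdim_right_orbifold_mat:
  assumes "(c :: 'k::field_char_0) \<noteq> 0"
  shows "qdim_right [X, Y, Z] [U, V, W] f_E30 4 4 (orbifold_mat c) \<noteq> 0"
proof -
  let ?p = "Const (96 * c ^ 15) * (Var U ^ 14 * Var V)"
  let ?s = "scaled_U c"
  let ?q = "- 3 * (4 * Const c * Var Z ^ 2
       - 2 * ?s * septic_U c - 4 * Const c * ?s ^ 2 * septic_X c) * Var Y
     - 12 * Const c * Var Z * Var V * Var Z
     + (6 * Var V * ?s * (Var X * partial U (quintic c) + 12 * ?s ^ 11 * Const c)
       + 12 * Const c * Var V * ?s ^ 2 * (2 * quintic c + Var X * partial X (quintic c))) * Var X"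
  have p: "?p = 96 * Const c * ?s ^ 14 * Var V"
  proof -
    have "c ^ 15 = c * c ^ 14" by (simp flip: power_Suc)
    then show ?thesis
      by (simp add: scaled_U_def power_mult_distrib Const_mult Const_power algebra_simps)
  qed
  have split: "supertrace 4 4 (deriv_product ([X, Y, Z] @ [U, V, W]) (orbifold_mat c)) = ?p + ?q"
    unfolding p append.simps supertrace_orbifold_mat septic_U_def septic_X_def
    by (simp add: algebra_simps eval_nat_numeral)
  have q: "?q \<in> powers_ideal {X, Y, Z} (\<lambda>_. 1)"
    unfolding diff_conv_add_uminus[of "_ * Var Y"]
    by (intro powers_ideal_add powers_ideal_uminus powers_ideal_mult Var_in_powers_ideal) simp_all
  have "Poly_Mapping.lookup (qdim_right [X, Y, Z] [U, V, W] f_E30 4 4 (orbifold_mat c)) 0 =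
      residue [U, V, W] ?p (gradient [U, V, W] f_E30)"
    unfolding qdim_right_def split
  proof (rule lookup_param_residue_0[OF _ _ _ q])
    show "residue_defined [U, V, W] (gradient [U, V, W] (f_E30 :: (variable, 'k) mpoly))"
      by (rule residue_definedI[OF E30_mat_poly _ E30_mat_gradient])
         (rule gradient_in_poly_vecs[OF graded_part_poly_ring[OF f_E30_graded]])
  qed (auto intro!: poly_ring_intros)
  also have "\<dots> \<noteq> 0" by (rule residue_E30) (use assms in simp)
  finally show ?thesis by auto
qed

theorem mainTheorem2:
  shows "(f_Q18 :: (variable, 'k::{alg_closed_field, field_char_0}) mpoly)
           \<in> graded_part weight [X, Y, Z] 2 \<and>
         (f_E30 :: (variable, 'k) mpoly) \<in> graded_part weight [U, V, W] 2 \<and>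
         orbifold_equivalent weight
           [X, Y, Z] (f_Q18 :: (variable, 'k) mpoly) [U, V, W] (f_E30 :: (variable, 'k) mpoly)"
proof (intro conjI f_Q18_graded f_E30_graded)
  \<comment> \<open>Algebraic closedness enters through this root alone.\<close>
  obtain c :: 'k where c: "c ^ 16 = - 1 / 4"
    using nth_root_exists[of 16 "- 1 / 4 :: 'k"] by auto
  then have "c \<noteq> 0" by auto
  obtain ns0 ns1 where ns: "length ns0 = 4" "length ns1 = 4"
    "matrix_factorization weight [X, Y, Z, U, V, W] (f_Q18 - f_E30) ns0 ns1 (orbifold_mat c)"
    using orbifold_mat_factorization[OF c] by blast
  with qdim_left_orbifold_mat[OF \<open>c \<noteq> 0\<close>] qdim_right_orbifold_mat[OF \<open>c \<noteq> 0\<close>]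
  show "orbifold_equivalent weight [X, Y, Z] (f_Q18 :: (variable, 'k) mpoly) [U, V, W] f_E30"
    unfolding orbifold_equivalent_def
    by (intro conjI potential_f_Q18 potential_f_E30 exI[of _ ns0] exI[of _ ns1]
        exI[of _ "orbifold_mat c"]) simp_all
qed

end
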